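(* Let $\mathbb{D},\mathbb{D}'$ be division rings with $|\mathbb{D}|\ge 4$, and let $m,n,m',n'\ge 2$ be integers with $\min\{m,n\}=2$. Suppose $\varphi:\mathbb{D}^{m\times n}\to\mathbb{D}'^{m'\times n'}$ is a degenerate graph homomorphism. Then there are two maximal sets $\mathcal{M}$ and $\mathcal{N}$ of different types containing $0$ in $\mathbb{D}'^{m'\times n'}$, and a matrix $R\in\mathbb{D}'^{m'\times n'}$, such that $$\varphi(\mathbb{D}^{m\times n})\subseteq(\mathcal{M}+R)\cup(\mathcal{N}+R).$$
   Context: For a division ring $\mathbb{D}$, matrices $A,B\in\mathbb{D}^{m\times n}$ are adjacent, written $A\sim B$, if $\mathrm{rank}(A-B)=1$. A map $\varphi:\mathbb{D}^{m\times n}\to\mathbb{D}'^{m'\times n'}$ is a graph homomorphism if $A\sim B$ implies $\varphi(A)\sim\varphi(B)$. An adjacent set is a nonempty set of matrices any two distinct members of which are adjacent; a maximal set is an adjacent set not properly contained in any other adjacent set. Let $\mathcal{M}_1\subset\mathbb{D}^{m\times n}$ be the set of matrices supported in the first row and $\mathcal{N}_1$ the set of matrices supported in the first column. For $m,n\ge2$, every maximal set of $\mathbb{D}^{m\times n}$ is either of type one, i.e. of the form $P\mathcal{M}_1+A$ with $P\in GL_m(\mathbb{D})$, $A\in\mathbb{D}^{m\times n}$, or of type two, i.e. of the form $\mathcal{N}_1Q+A$ with $Q\in GL_n(\mathbb{D})$, $A\in\mathbb{D}^{m\times n}$ (and likewise over $\mathbb{D}'$). $\mathbb{D}^{m\times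 n}_{\le 1}=\{X\in\mathbb{D}^{m\times n}:\mathrm{rank}(X)\le 1\}$, and $\mathbb{B}_A=\mathbb{D}^{m\times n}_{\le 1}+A$. A graph homomorphism $\varphi:\mathbb{D}^{m\times n}\to\mathbb{D}'^{m'\times n'}$ is degenerate if there exist a matrix $A\in\mathbb{D}^{m\times n}_{\le 1}$ and two maximal sets $\mathcal{M},\mathcal{N}$ of different types in $\mathbb{D}'^{m'\times n'}$ such that $\varphi(\mathbb{B}_A)\subseteq\mathcal{M}\cup\mathcal{N}$ and $\varphi(A)\in\mathcal{M}\cap\mathcal{N}$. *)

theory Defs
  imports "Jordan_Normal_Form.Matrix"
begin

(* The scalars are arbitrary division rings, so sides matter: rows are regarded as vectors of a
   left vector space, columns as vectors of a right one. The rank is the row rank, i.e. the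
   maximal number of left linearly independent rows (it coincides with the maximal number of
   right linearly independent columns). *)
definition left_indep_rows :: "'a::division_ring mat \<Rightarrow> nat set \<Rightarrow> bool" where
  "left_indep_rows A I \<longleftrightarrow>
     (\<forall>c :: nat \<Rightarrow> 'a. (\<forall>j < dim_col A. (\<Sum>i\<in>I. c i * A $$ (i, j)) = 0) \<longrightarrow> (\<forall>i\<in>I. c i = 0))"

definition mat_rank :: "'a::division_ring mat \<Rightarrow> nat" where
  "mat_rank A = Max {card I | I. I \<subseteq> {..<dim_row A} \<and> left_indep_rows A I}"

definition adjacent :: "'a::division_ring mat \<Rightarrow> 'a mat \<Rightarrow> bool" where
  "adjacent A B \<longleftrightarrow> mat_rank (A - B) = 1"

definition graph_hom ::
    "nat \<Rightarrow> nat \<Rightarrow> nat \<Rightarrow> nat \<Rightarrow> ('a::division_ring mat \<Rightarrow> 'b::division_ring mat) \<Rightarrow> bool" where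
  "graph_hom m n m' n' \<phi> \<longleftrightarrow>
     \<phi> \<in> carrier_mat m n \<rightarrow> carrier_mat m' n' \<and>
     (\<forall>A \<in> carrier_mat m n. \<forall>B \<in> carrier_mat m n. adjacent A B \<longrightarrow> adjacent (\<phi> A) (\<phi> B))"

definition adjacent_set :: "nat \<Rightarrow> nat \<Rightarrow> 'a::division_ring mat set \<Rightarrow> bool" where
  "adjacent_set m n S \<longleftrightarrow>
     S \<noteq> {} \<and> S \<subseteq> carrier_mat m n \<and> (\<forall>A \<in> S. \<forall>B \<in> S. A \<noteq> B \<longrightarrow> adjacent A B)"

definition maximal_set :: "nat \<Rightarrow> nat \<Rightarrow> 'a::division_ring mat set \<Rightarrow> bool" where
  "maximal_set m n S \<longleftrightarrow> adjacent_set m n S \<and> \<not> (\<exists>T. adjacent_set m n T \<and> S \<subset> T)"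

definition first_row_mats :: "nat \<Rightarrow> nat \<Rightarrow> 'a::division_ring mat set" where
  "first_row_mats m n = {X \<in> carrier_mat m n. \<forall>i < m. \<forall>j < n. i \<noteq> 0 \<longrightarrow> X $$ (i, j) = 0}"

definition first_col_mats :: "nat \<Rightarrow> nat \<Rightarrow> 'a::division_ring mat set" where
  "first_col_mats m n = {X \<in> carrier_mat m n. \<forall>i < m. \<forall>j < n. j \<noteq> 0 \<longrightarrow> X $$ (i, j) = 0}"

definition maximal_type_one :: "nat \<Rightarrow> nat \<Rightarrow> 'a::division_ring mat set \<Rightarrow> bool" where
  "maximal_type_one m n S \<longleftrightarrow> maximal_set m n S \<and>
     (\<exists>P \<in> carrier_mat m m. \<exists>A \<in> carrier_mat m n. invertible_mat P \<and>
        S = (\<lambda>X. P * X + A) ` first_row_mats m n)"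

definition maximal_type_two :: "nat \<Rightarrow> nat \<Rightarrow> 'a::division_ring mat set \<Rightarrow> bool" where
  "maximal_type_two m n S \<longleftrightarrow> maximal_set m n S \<and>
     (\<exists>Q \<in> carrier_mat n n. \<exists>A \<in> carrier_mat m n. invertible_mat Q \<and>
        S = (\<lambda>X. X * Q + A) ` first_col_mats m n)"

definition maximal_different_types ::
    "nat \<Rightarrow> nat \<Rightarrow> 'a::division_ring mat set \<Rightarrow> 'a mat set \<Rightarrow> bool" where
  "maximal_different_types m n S T \<longleftrightarrow>
     (maximal_type_one m n S \<and> maximal_type_two m n T) \<or>
     (maximal_type_two m n S \<and> maximal_type_one m n T)"

definition rank_le_one :: "nat \<Rightarrow> nat \<Rightarrow> 'a::division_ring mat set" where
  "rank_le_one m n = {X \<in> carrier_mat m n. mat_rank X \<le> 1}"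

definition unit_ball :: "nat \<Rightarrow> nat \<Rightarrow> 'a::division_ring mat \<Rightarrow> 'a mat set" where
  "unit_ball m n A = (\<lambda>X. X + A) ` rank_le_one m n"

definition degenerate_hom ::
    "nat \<Rightarrow> nat \<Rightarrow> nat \<Rightarrow> nat \<Rightarrow> ('a::division_ring mat \<Rightarrow> 'b::division_ring mat) \<Rightarrow> bool" where
  "degenerate_hom m n m' n' \<phi> \<longleftrightarrow> graph_hom m n m' n' \<phi> \<and>
     (\<exists>A \<in> rank_le_one m n. \<exists>M N. maximal_different_types m' n' M N \<and>
        \<phi> ` unit_ball m n A \<subseteq> M \<union> N \<and> \<phi> A \<in> M \<inter> N)"

end

theory Submission
  imports Defs
begin

text \<open>
  Let \<open>m = 2\<close>, and let \<open>M\<close>, \<open>N\<close> be maximal sets of types one and two that meet in the image of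
  \<open>A\<close> and cover the image of the ball around \<open>A\<close>. Suppose that some \<open>B\<close> is mapped outside
  \<open>M \<union> N\<close>. The common neighbours of \<open>A\<close> and \<open>B\<close> correspond to ordered pairs of distinct points of
  the projective line, two of them being adjacent if they share a coordinate. An element of \<open>M - N\<close> is never
  adjacent to an element of \<open>N - M\<close>, and the image of \<open>B\<close> has at most one neighbour in \<open>M \<inter> N\<close>.
  As the projective line has at least five points, all common neighbours are mapped
  into one of the two sets, say \<open>M\<close>, and then so is the whole ball around \<open>A\<close>.

  Every matrix mapped outside \<open>M\<close> now has all its neighbours mapped into a single maximal set of
  the other type. Any two distinct matrices with two rows are at distance at most two, and there are
  two matrices with distinct images each of which is equal or adjacent to both of them. Since two
  maximal sets of the same type with two common elements are equal, the same set serves for all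
  matrices mapped outside \<open>M\<close>.

  The cases \<open>n = 2\<close> and ``the ball is mapped into \<open>N\<close>'' follow by transposition over the
  opposite division ring.
\<close>

subsection \<open>Matrices of rank one\<close>

text \<open>If \<open>c\<close> is not a right multiple of \<open>a\<close>, subtracting
  \<open>g\<close> times row \<open>i0\<close> from row \<open>k\<close> cancels the term with
  \<open>b\<close> and leaves \<open>p * d j = q * t j\<close> with \<open>p \<noteq> 0\<close>. As
  \<open>d\<close> does not vanish, \<open>q \<noteq> 0\<close>; hence \<open>t\<close>, and by row
  \<open>i0\<close> also \<open>b\<close>, is a left multiple of \<open>d\<close>.\<close>

lemma rank_one_sum:
  fixes a c s b d t :: "nat \<Rightarrow> 'a::division_ring"
  assumes eq: "\<And>i j. i < m \<Longrightarrow> j < n \<Longrightarrow> a i * b j + c i * d j = s i * t j"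
    and i0: "i0 < m" "a i0 \<noteq> 0" and j0: "j0 < n" "d j0 \<noteq> 0"
  shows "(\<exists>l. \<forall>i<m. c i = a i * l) \<or> (\<exists>l. \<forall>j<n. b j = l * d j)"
proof (cases "\<forall>i<m. c i = a i * (inverse (a i0) * c i0)")
  case False
  then obtain k where k: "k < m" "c k \<noteq> a k * (inverse (a i0) * c i0)" by blast
  define g where "g = a k * inverse (a i0)"
  define p where "p = c k - g * c i0"
  define q where "q = s k - g * s i0"
  have p0: "p \<noteq> 0" using k by (simp add: p_def g_def mult.assoc)
  have ga: "g * a i0 = a k" using i0 by (simp add: g_def mult.assoc)
  have pq: "p * d j = q * t j" if "j < n" for j
  proof -
    have "q * t j = s k * t j - g * (s i0 * t j)" by (simp add: q_def algebra_simps)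
    also have "\<dots> = a k * b j + c k * d j - g * (a i0 * b j + c i0 * d j)"
      using eq[OF k(1) that] eq[OF i0(1) that] by simp
    also have "g * (a i0 * b j + c i0 * d j) = a k * b j + g * (c i0 * d j)"
      by (simp add: distrib_left mult.assoc[symmetric] ga)
    also have "a k * b j + c k * d j - (a k * b j + g * (c i0 * d j)) = p * d j"
      by (simp add: p_def algebra_simps)
    finally show ?thesis by simp
  qed
  have q0: "q \<noteq> 0" using pq[OF j0(1)] p0 j0 by auto
  have t: "t j = inverse q * p * d j" if "j < n" for j
  proof -
    have "inverse q * p * d j = inverse q * (p * d j)" by (simp add: mult.assoc)
    also have "\<dots> = t j" using q0 by (simp add: pq[OF that] mult.assoc[symmetric])
    finally show ?thesis by simp
  qed
  have "b j = inverse (a i0) * (s i0 * inverse q * p - c i0) * d j" if "j < n" for j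
  proof -
    have "a i0 * b j = s i0 * t j - c i0 * d j"
      using eq[OF i0(1) that] by (simp add: eq_diff_eq)
    also have "\<dots> = (s i0 * inverse q * p - c i0) * d j"
      by (simp only: t[OF that] left_diff_distrib mult.assoc)
    finally have "a i0 * b j = (s i0 * inverse q * p - c i0) * d j" .
    then have "inverse (a i0) * (a i0 * b j) = inverse (a i0) * ((s i0 * inverse q * p - c i0) * d j)"
      by simp
    then show ?thesis using i0 by (simp add: mult.assoc[symmetric])
  qed
  then show ?thesis by blast
qed blast

text \<open>The variant in which \<open>b\<close> rather than \<open>d\<close> is known not to
  vanish. Either \<open>d\<close> is zero, or the factor in \<open>b j = l * d j\<close> is nonzero
  and can be moved to the other side.\<close>

lemma rank_one_sum':
  fixes a c s b d t :: "nat \<Rightarrow> 'a::division_ring"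
  assumes eq: "\<And>i j. i < m \<Longrightarrow> j < n \<Longrightarrow> a i * b j + c i * d j = s i * t j"
    and i0: "i0 < m" "a i0 \<noteq> 0" and j0: "j0 < n" "b j0 \<noteq> 0"
  shows "(\<exists>l. \<forall>i<m. c i = a i * l) \<or> (\<exists>l. \<forall>j<n. d j = l * b j)"
proof (cases "\<exists>j1<n. d j1 \<noteq> 0")
  case True
  then obtain j1 where "j1 < n" "d j1 \<noteq> 0" by blast
  from rank_one_sum[of m n a b c d s t i0 j1, OF eq i0 this] consider "\<exists>l. \<forall>i<m. c i = a i * l"
    | l where "\<forall>j<n. b j = l * d j" by metis
  then show ?thesis
  proof cases
    case 2
    then have "l \<noteq> 0" using j0 by auto
    with 2 have "\<forall>j<n. d j = inverse l * b j" by (simp add: mult.assoc[symmetric])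
    then show ?thesis by blast
  qed blast
next
  case False
  then have "\<forall>j<n. d j = 0 * b j" by simp
  then show ?thesis by blast
qed

text \<open>Being equal or adjacent, in a form suited to computation: the difference is a column
  times a row. Vectors are functions on all naturals, of which only the values at valid indices
  matter.\<close>

definition near :: "nat \<Rightarrow> nat \<Rightarrow> 'a::division_ring mat \<Rightarrow> 'a mat \<Rightarrow> bool" where
  "near m n A B \<longleftrightarrow> (\<exists>x y. \<forall>i<m. \<forall>j<n. B $$ (i, j) = A $$ (i, j) + x i * y j)"

lemma nearI:
  assumes "\<And>i j. i < m \<Longrightarrow> j < n \<Longrightarrow> B $$ (i, j) = A $$ (i, j) + x i * y j"
  shows "near m n A B"
  unfolding near_def using assms by (intro exI[of _ x] exI[of _ y]) simp

lemma nearE: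
  assumes "near m n A B"
  obtains x y where "\<forall>i<m. \<forall>j<n. B $$ (i, j) = A $$ (i, j) + x i * y j"
  using assms unfolding near_def by metis

lemma near_refl: "near m n A A"
  by (rule nearI[where x = "\<lambda>_. 0"]) simp

lemma near_sym: "near m n A B \<Longrightarrow> near m n B A"
proof (erule nearE)
  fix x y assume "\<forall>i<m. \<forall>j<n. B $$ (i, j) = A $$ (i, j) + x i * y j"
  then show "near m n B A" by (intro nearI[where x = "\<lambda>i. - x i" and y = y]) simp
qed

lemma left_indep_rows_singleton:
  "left_indep_rows (A :: 'a::division_ring mat) {i} \<longleftrightarrow> (\<exists>j < dim_col A. A $$ (i, j) \<noteq> 0)"
proof
  assume "left_indep_rows A {i}"
  then have "(\<forall>j<dim_col A. (\<Sum>i\<in>{i}. (\<lambda>_. 1) i * A $$ (i, j)) = 0) \<longrightarrow>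
      (\<forall>i\<in>{i}. (1::'a) = 0)"
    unfolding left_indep_rows_def by (rule spec)
  then show "\<exists>j < dim_col A. A $$ (i, j) \<noteq> 0" by auto
qed (auto simp: left_indep_rows_def)

lemma left_indep_rows_mono:
  assumes "left_indep_rows A I" "J \<subseteq> I" "finite I"
  shows "left_indep_rows A J"
  unfolding left_indep_rows_def
proof (intro allI impI ballI)
  fix c i assume c: "\<forall>j<dim_col A. (\<Sum>i\<in>J. c i * A $$ (i, j)) = 0" and i: "i \<in> J"
  define c' where "c' k = (if k \<in> J then c k else 0)" for k
  have "(\<Sum>k\<in>I. c' k * A $$ (k, j)) = (\<Sum>k\<in>J. c k * A $$ (k, j))" for j
    using assms(2,3) by (intro sum.mono_neutral_cong_right) (auto simp: c'_def)
  with c have "\<forall>j<dim_col A. (\<Sum>k\<in>I. c' k * A $$ (k, j)) = 0" by simp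
  with assms(1) have "\<forall>i\<in>I. c' i = 0" unfolding left_indep_rows_def by blast
  moreover have "i \<in> I" using i assms(2) by blast
  ultimately have "c' i = 0" by blast
  then show "c i = 0" using i by (simp add: c'_def)
qed

text \<open>Subsets of independent sets of rows are independent, so the maximum is controlled by
  singletons and pairs alone.\<close>

lemma mat_rank_eq_one_iff:
  "mat_rank A = 1 \<longleftrightarrow> (\<exists>i<dim_row A. left_indep_rows A {i}) \<and>
     (\<forall>i<dim_row A. \<forall>k<dim_row A. i \<noteq> k \<longrightarrow> \<not> left_indep_rows A {i, k})"
proof -
  define S where "S = {card I | I. I \<subseteq> {..<dim_row A} \<and> left_indep_rows A I}"
  have "S \<subseteq> card ` Pow {..<dim_row A}" unfolding S_def by auto
  then have fin: "finite S" by (rule finite_subset) simp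
  have "0 \<in> S" unfolding S_def by (auto intro!: exI[of _ "{}"] simp: left_indep_rows_def)
  then have ne: "S \<noteq> {}" by blast
  have rank: "mat_rank A = Max S" unfolding mat_rank_def S_def ..
  have one: "1 \<in> S \<longleftrightarrow> (\<exists>i<dim_row A. left_indep_rows A {i})"
  proof
    assume "1 \<in> S"
    then obtain I where I: "card I = 1" "I \<subseteq> {..<dim_row A}" "left_indep_rows A I"
      unfolding S_def by auto
    from I(1) obtain i where "I = {i}" by (rule card_1_singletonE)
    with I show "\<exists>i<dim_row A. left_indep_rows A {i}" by auto
  next
    assume "\<exists>i<dim_row A. left_indep_rows A {i}"
    then obtain i where "i < dim_row A" "left_indep_rows A {i}" by blast
    then show "1 \<in> S" unfolding S_def by (auto intro!: exI[of _ "{i}"])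
  qed
  have two: "(\<forall>k\<in>S. k \<le> 1) \<longleftrightarrow>
      (\<forall>i<dim_row A. \<forall>k<dim_row A. i \<noteq> k \<longrightarrow> \<not> left_indep_rows A {i, k})"
  proof
    assume *: "\<forall>k\<in>S. k \<le> 1"
    show "\<forall>i<dim_row A. \<forall>k<dim_row A. i \<noteq> k \<longrightarrow> \<not> left_indep_rows A {i, k}"
    proof (intro allI impI notI)
      fix i k assume "i < dim_row A" "k < dim_row A" "i \<noteq> k" "left_indep_rows A {i, k}"
      then have "card {i, k} \<in> S" unfolding S_def by blast
      with * \<open>i \<noteq> k\<close> show False by auto
    qed
  next
    assume *: "\<forall>i<dim_row A. \<forall>k<dim_row A. i \<noteq> k \<longrightarrow> \<not> left_indep_rows A {i, k}"
    show "\<forall>k\<in>S. k \<le> 1"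
    proof (rule ccontr)
      assume "\<not> ?thesis"
      then obtain I where I: "\<not> card I \<le> 1" "I \<subseteq> {..<dim_row A}" "left_indep_rows A I"
        unfolding S_def by blast
      have fI: "finite I" using I(2) finite_subset by blast
      have "\<exists>i\<in>I. \<exists>k\<in>I. i \<noteq> k" using I(1) fI
        by (simp add: card_le_Suc0_iff_eq)
      then obtain i k where ik: "i \<in> I" "k \<in> I" "i \<noteq> k" by blast
      have "left_indep_rows A {i, k}" using left_indep_rows_mono[OF I(3) _ fI] ik by simp
      with * ik I(2) show False by blast
    qed
  qed
  have "Max S = 1 \<longleftrightarrow> 1 \<in> S \<and> (\<forall>k\<in>S. k \<le> 1)" using fin ne Max_eq_iff by blast
  then show ?thesis using rank one two by simp
qed

text \<open>In a matrix of rank one each row depends on a fixed nonzero row, hence is a left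
  multiple of it. Conversely, any two rows of a column times a row satisfy an explicit linear
  relation.\<close>

lemma adjacent_iff:
  assumes "A \<in> carrier_mat m n" "B \<in> carrier_mat m n"
  shows "adjacent A B \<longleftrightarrow> A \<noteq> B \<and> near m n A B"
proof -
  let ?D = "A - B"
  have D: "dim_row ?D = m" "dim_col ?D = n" using assms by auto
  have Dij: "?D $$ (i, j) = A $$ (i, j) - B $$ (i, j)" if "i < m" "j < n" for i j
    using that assms by simp
  have ne: "A \<noteq> B \<longleftrightarrow> (\<exists>i<m. \<exists>j<n. ?D $$ (i, j) \<noteq> 0)"
    using assms Dij by (auto intro!: eq_matI)
  show ?thesis
  proof
    assume "adjacent A B"
    then obtain i where i: "i < m" "left_indep_rows ?D {i}"
      and dep: "\<forall>i<m. \<forall>k<m. i \<noteq> k \<longrightarrow> \<not> left_indep_rows ?D {i, k}"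
      unfolding adjacent_def mat_rank_eq_one_iff D by blast
    from i obtain j0 where j0: "j0 < n" "?D $$ (i, j0) \<noteq> 0"
      using D by (auto simp: left_indep_rows_singleton)
    have "\<exists>l. \<forall>j<n. ?D $$ (k, j) = l * ?D $$ (i, j)" if k: "k < m" for k
    proof (cases "k = i")
      case True
      then show ?thesis by (intro exI[of _ 1]) simp
    next
      case False
      with dep i k have "\<not> left_indep_rows ?D {i, k}" by auto
      then obtain c where c: "\<forall>j<n. (\<Sum>p\<in>{i, k}. c p * ?D $$ (p, j)) = 0"
        "\<not> (\<forall>p\<in>{i, k}. c p = 0)"
        unfolding left_indep_rows_def D by blast
      from c(1) have c1: "c i * ?D $$ (i, j) + c k * ?D $$ (k, j) = 0" if "j < n" for j
        using that False by simp
      from c(2) have c2: "c i \<noteq> 0 \<or> c k \<noteq> 0" by blast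
      \<comment> \<open>If \<open>c k\<close> were zero, the relation at column \<open>j0\<close>
        would give \<open>c i = 0\<close> as well.\<close>
      have ck: "c k \<noteq> 0" using c1[OF j0(1)] c2 j0(2) by auto
      have "?D $$ (k, j) = (- inverse (c k) * c i) * ?D $$ (i, j)" if "j < n" for j
      proof -
        have "c k * ?D $$ (k, j) = - (c i * ?D $$ (i, j))" using c1[OF that]
          by (simp add: eq_neg_iff_add_eq_0 add.commute)
        then have "inverse (c k) * (c k * ?D $$ (k, j)) = inverse (c k) * - (c i * ?D $$ (i, j))"
          by simp
        then show ?thesis using ck by (simp add: mult.assoc[symmetric])
      qed
      then show ?thesis by blast
    qed
    then obtain l where "\<And>k j. k < m \<Longrightarrow> j < n \<Longrightarrow> ?D $$ (k, j) = l k * ?D $$ (i, j)" by metis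
    then have "B $$ (k, j) = A $$ (k, j) + - l k * ?D $$ (i, j)" if "k < m" "j < n" for k j
      using that Dij[OF that] by (simp add: algebra_simps)
    then have "near m n A B" by (rule nearI)
    moreover have "A \<noteq> B" using ne i j0 by blast
    ultimately show "A \<noteq> B \<and> near m n A B" by simp
  next
    assume AB: "A \<noteq> B \<and> near m n A B"
    then have "\<exists>i<m. left_indep_rows ?D {i}" using ne D by (auto simp: left_indep_rows_singleton)
    moreover have "\<not> left_indep_rows ?D {i, k}" if ik: "i < m" "k < m" "i \<noteq> k" for i k
    proof
      assume ind: "left_indep_rows ?D {i, k}"
      from AB have nr: "near m n A B" by simp
      from near_sym[OF nr] obtain x y
        where "\<forall>i<m. \<forall>j<n. A $$ (i, j) = B $$ (i, j) + x i * y j"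
        by (rule nearE)
      then have xy: "?D $$ (i, j) = x i * y j" if "i < m" "j < n" for i j
        using Dij that by simp
      \<comment> \<open>A nontrivial relation between rows \<open>i\<close> and \<open>k\<close>:
        row \<open>i\<close> alone if it vanishes, otherwise row \<open>k\<close> minus the suitable
        left multiple of row \<open>i\<close>.\<close>
      define c where "c p = (if x i = 0 then (if p = i then 1 else 0)
        else if p = k then 1 else - (x k * inverse (x i)))" for p
      have "\<forall>j<n. (\<Sum>p\<in>{i,k}. c p * ?D $$ (p, j)) = 0"
      proof (intro allI impI)
        fix j assume j: "j < n"
        have "(\<Sum>p\<in>{i,k}. c p * ?D $$ (p, j)) = c i * (x i * y j) + c k * (x k * y j)"
          using ik xy j by simp
        also have "\<dots> = (c i * x i + c k * x k) * y j"
          by (simp add: distrib_right mult.assoc)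
        also have "c i * x i + c k * x k = 0"
          using ik by (simp add: c_def mult.assoc)
        finally show "(\<Sum>p\<in>{i,k}. c p * ?D $$ (p, j)) = 0" by simp
      qed
      with ind have "\<forall>p\<in>{i,k}. c p = 0" unfolding left_indep_rows_def D by blast
      then show False using ik by (simp add: c_def split: if_splits)
    qed
    ultimately show "adjacent A B"
      unfolding adjacent_def mat_rank_eq_one_iff D by blast
  qed
qed

subsection \<open>Maximal sets\<close>

text \<open>For nonzero \<open>x\<close> this is the type one maximal set through \<open>A\<close>
  with column direction \<open>x\<close>, and dually \<open>col_set\<close> is of type two. A vector
  stands in for the invertible matrix \<open>P\<close>, of which only the first column
  matters.\<close>

definition row_set :: "nat \<Rightarrow> nat \<Rightarrow> 'a::division_ring mat \<Rightarrow> (nat \<Rightarrow> 'a) \<Rightarrow> 'a mat set" where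
  "row_set m n A x = {X \<in> carrier_mat m n. \<exists>v. \<forall>i<m. \<forall>j<n. X $$ (i, j) = A $$ (i, j) + x i * v j}"

definition col_set :: "nat \<Rightarrow> nat \<Rightarrow> 'a::division_ring mat \<Rightarrow> (nat \<Rightarrow> 'a) \<Rightarrow> 'a mat set" where
  "col_set m n A y = {X \<in> carrier_mat m n. \<exists>w. \<forall>i<m. \<forall>j<n. X $$ (i, j) = A $$ (i, j) + w i * y j}"

lemma row_setI:
  assumes "X \<in> carrier_mat m n" "\<And>i j. i < m \<Longrightarrow> j < n \<Longrightarrow> X $$ (i, j) = A $$ (i, j) + x i * v j"
  shows "X \<in> row_set m n A x"
  unfolding row_set_def using assms by (intro CollectI conjI exI[of _ v]) simp_all

lemma col_setI:
  assumes "X \<in> carrier_mat m n" "\<And>i j. i < m \<Longrightarrow> j < n \<Longrightarrow> X $$ (i, j) = A $$ (i, j) + w i * y j"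
  shows "X \<in> col_set m n A y"
  unfolding col_set_def using assms by (intro CollectI conjI exI[of _ w]) simp_all

lemma row_setE:
  assumes "X \<in> row_set m n A x"
  obtains v where "X \<in> carrier_mat m n"
    "\<forall>i<m. \<forall>j<n. X $$ (i, j) = A $$ (i, j) + x i * v j"
  using assms unfolding row_set_def by blast

lemma col_setE:
  assumes "X \<in> col_set m n A y"
  obtains w where "X \<in> carrier_mat m n"
    "\<forall>i<m. \<forall>j<n. X $$ (i, j) = A $$ (i, j) + w i * y j"
  using assms unfolding col_set_def by blast

lemma base_in_row_set: "A \<in> carrier_mat m n \<Longrightarrow> A \<in> row_set m n A x"
  by (rule row_setI[where v = "\<lambda>_. 0"]) simp_all

lemma base_in_col_set: "A \<in> carrier_mat m n \<Longrightarrow> A \<in> col_set m n A y"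
  by (rule col_setI[where w = "\<lambda>_. 0"]) simp_all

text \<open>Any member may serve as base point, so that two sets with a common element can be
  compared through their directions.\<close>

lemma row_set_rebase:
  assumes "R \<in> row_set m n A x"
  shows "row_set m n A x = row_set m n R x"
proof -
  from assms obtain v where v: "\<forall>i<m. \<forall>j<n. R $$ (i, j) = A $$ (i, j) + x i * v j"
    by (rule row_setE) blast
  show ?thesis
  proof (intro Set.set_eqI iffI)
    fix X assume "X \<in> row_set m n A x"
    then obtain u where "X \<in> carrier_mat m n"
      "\<forall>i<m. \<forall>j<n. X $$ (i, j) = A $$ (i, j) + x i * u j" by (rule row_setE) blast
    then show "X \<in> row_set m n R x"
      by (intro row_setI[where v = "\<lambda>j. u j - v j"]) (simp_all add: v right_diff_distrib)
  next
    fix X assume "X \<in> row_set m n R x"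
    then obtain u where "X \<in> carrier_mat m n"
      "\<forall>i<m. \<forall>j<n. X $$ (i, j) = R $$ (i, j) + x i * u j" by (rule row_setE) blast
    then show "X \<in> row_set m n A x"
      by (intro row_setI[where v = "\<lambda>j. v j + u j"]) (simp_all add: v distrib_left add.assoc)
  qed
qed

lemma col_set_rebase:
  assumes "R \<in> col_set m n A y"
  shows "col_set m n A y = col_set m n R y"
proof -
  from assms obtain w where w: "\<forall>i<m. \<forall>j<n. R $$ (i, j) = A $$ (i, j) + w i * y j"
    by (rule col_setE) blast
  show ?thesis
  proof (intro Set.set_eqI iffI)
    fix X assume "X \<in> col_set m n A y"
    then obtain u where "X \<in> carrier_mat m n"
      "\<forall>i<m. \<forall>j<n. X $$ (i, j) = A $$ (i, j) + u i * y j" by (rule col_setE) blast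
    then show "X \<in> col_set m n R y"
      by (intro col_setI[where w = "\<lambda>i. u i - w i"]) (simp_all add: w left_diff_distrib)
  next
    fix X assume "X \<in> col_set m n R y"
    then obtain u where "X \<in> carrier_mat m n"
      "\<forall>i<m. \<forall>j<n. X $$ (i, j) = R $$ (i, j) + u i * y j" by (rule col_setE) blast
    then show "X \<in> col_set m n A y"
      by (intro col_setI[where w = "\<lambda>i. w i + u i"]) (simp_all add: w distrib_right add.assoc)
  qed
qed

subsection \<open>Transposition along an anti-isomorphism of the scalars\<close>

text \<open>Over a noncommutative division ring transposition does not preserve rank. Combined with
  a passage to the opposite ring it does, and it exchanges the two types of maximal sets.\<close>
definition anti_iso :: "('a::division_ring \<Rightarrow> 'b::division_ring) \<Rightarrow> bool" where
  "anti_iso f \<longleftrightarrow> bij f \<and> (\<forall>a b. f (a + b) = f a + f b) \<and> (\<forall>a b. f (a * b) = f b * f a)"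

definition tr :: "('a \<Rightarrow> 'b) \<Rightarrow> 'a mat \<Rightarrow> 'b mat" where
  "tr f A = mat (dim_col A) (dim_row A) (\<lambda>(i, j). f (A $$ (j, i)))"

lemma tr_carrier [simp]: "A \<in> carrier_mat m n \<Longrightarrow> tr f A \<in> carrier_mat n m"
  by (auto simp: tr_def)

lemma tr_index: "A \<in> carrier_mat m n \<Longrightarrow> i < n \<Longrightarrow> j < m \<Longrightarrow> tr f A $$ (i, j) = f (A $$ (j, i))"
  by (auto simp: tr_def)

lemma anti_iso_zero: "anti_iso f \<Longrightarrow> f 0 = 0"
  unfolding anti_iso_def by (metis add_cancel_right_right add_0)

lemma anti_iso_one:
  assumes "anti_iso f" shows "f 1 = 1"
proof -
  have "f 1 \<noteq> f 0" using assms unfolding anti_iso_def by (metis bij_pointE zero_neq_one)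
  then have "f 1 \<noteq> 0" using anti_iso_zero[OF assms] by simp
  moreover have "f 1 * f 1 = f 1 * 1" using assms unfolding anti_iso_def by (metis mult_1_right)
  ultimately show ?thesis by (metis mult_left_cancel)
qed

lemma anti_iso_inv:
  assumes "anti_iso f" shows "anti_iso (inv_into UNIV f)"
proof -
  have b: "bij f" and add: "\<And>a b. f (a + b) = f a + f b" and mult: "\<And>a b. f (a * b) = f b * f a"
    using assms by (auto simp: anti_iso_def)
  have fi: "f (inv_into UNIV f a) = a" for a using b by (simp add: bij_is_surj surj_f_inv_f)
  have inj: "inj f" using b by (rule bij_is_inj)
  show ?thesis unfolding anti_iso_def
  proof (intro conjI allI)
    show "bij (inv_into UNIV f)" using b by (rule bij_imp_bij_inv)
    show "inv_into UNIV f (a + b) = inv_into UNIV f a + inv_into UNIV f b" for a b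
      by (rule injD[OF inj]) (simp add: fi add)
    show "inv_into UNIV f (a * b) = inv_into UNIV f b * inv_into UNIV f a" for a b
      by (rule injD[OF inj]) (simp add: fi mult)
  qed
qed

lemma tr_inv_tr: "anti_iso f \<Longrightarrow> A \<in> carrier_mat m n \<Longrightarrow> tr (inv_into UNIV f) (tr f A) = A"
  by (rule eq_matI) (auto simp: tr_def anti_iso_def bij_is_inj)

lemma tr_tr_inv: "anti_iso f \<Longrightarrow> A \<in> carrier_mat m n \<Longrightarrow> tr f (tr (inv_into UNIV f) A) = A"
  by (rule eq_matI) (auto simp: tr_def anti_iso_def bij_is_surj surj_f_inv_f)

lemma near_tr:
  assumes f: "anti_iso f" and AB: "A \<in> carrier_mat m n" "B \<in> carrier_mat m n" and "near m n A B"
  shows "near n m (tr f A) (tr f B)"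
proof -
  from assms(4) obtain x y where "\<forall>i<m. \<forall>j<n. B $$ (i, j) = A $$ (i, j) + x i * y j"
    by (rule nearE)
  then show ?thesis using f AB
    by (intro nearI[where x = "\<lambda>i. f (y i)" and y = "\<lambda>j. f (x j)"])
      (simp add: tr_index anti_iso_def)
qed

lemma adjacent_tr:
  assumes f: "anti_iso f" and A: "A \<in> carrier_mat m n" and B: "B \<in> carrier_mat m n"
  shows "adjacent (tr f A) (tr f B) \<longleftrightarrow> adjacent A B"
proof -
  have "near n m (tr f A) (tr f B) \<longleftrightarrow> near m n A B"
    using near_tr[OF f A B] near_tr[OF anti_iso_inv[OF f] tr_carrier[OF A, of f] tr_carrier[OF B, of f]]
    by (auto simp: tr_inv_tr[OF f A] tr_inv_tr[OF f B])
  moreover have "tr f A = tr f B \<longleftrightarrow> A = B" using tr_inv_tr[OF f A] tr_inv_tr[OF f B] by metis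
  ultimately show ?thesis
    using adjacent_iff[OF A B] adjacent_iff[OF tr_carrier[OF A] tr_carrier[OF B]] by blast
qed

lemma adjacent_set_tr:
  assumes f: "anti_iso f" and S: "adjacent_set m n S"
  shows "adjacent_set n m (tr f ` S)"
proof -
  have Sc: "X \<in> carrier_mat m n" if "X \<in> S" for X
    using S that unfolding adjacent_set_def by blast
  have adj: "adjacent (tr f A) (tr f B)" if "A \<in> S" "B \<in> S" "tr f A \<noteq> tr f B" for A B
  proof -
    have "A \<noteq> B" using that(3) by auto
    then have "adjacent A B" using S that(1,2) unfolding adjacent_set_def by blast
    then show ?thesis using adjacent_tr[OF f Sc[OF that(1)] Sc[OF that(2)]] by simp
  qed
  show ?thesis unfolding adjacent_set_def
  proof (intro conjI ballI impI)
    show "tr f ` S \<noteq> {}" using S by (simp add: adjacent_set_def)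
    show "tr f ` S \<subseteq> carrier_mat n m" using Sc by (auto intro: tr_carrier)
    fix X Y assume "X \<in> tr f ` S" "Y \<in> tr f ` S" "X \<noteq> Y"
    then show "adjacent X Y" using adj by blast
  qed
qed

text \<open>The inverse anti-isomorphism would carry a strictly larger adjacent set back to one
  strictly containing \<open>S\<close>.\<close>

lemma maximal_set_tr:
  assumes f: "anti_iso f" and S: "maximal_set m n S"
  shows "maximal_set n m (tr f ` S)"
  unfolding maximal_set_def
proof (intro conjI notI)
  show "adjacent_set n m (tr f ` S)"
    using S by (intro adjacent_set_tr[OF f]) (simp add: maximal_set_def)
  assume "\<exists>T. adjacent_set n m T \<and> tr f ` S \<subset> T"
  then obtain T where T: "adjacent_set n m T" "tr f ` S \<subset> T" by blast
  have Sc: "S \<subseteq> carrier_mat m n" using S by (auto simp: maximal_set_def adjacent_set_def)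
  have Tc: "T \<subseteq> carrier_mat n m" using T by (auto simp: adjacent_set_def)
  have "adjacent_set m n (tr (inv_into UNIV f) ` T)" by (rule adjacent_set_tr[OF anti_iso_inv[OF f] T(1)])
  moreover have "S \<subset> tr (inv_into UNIV f) ` T"
  proof
    show "S \<subseteq> tr (inv_into UNIV f) ` T"
    proof
      fix X assume "X \<in> S"
      then have "tr f X \<in> T" "tr (inv_into UNIV f) (tr f X) = X" using T Sc tr_inv_tr[OF f] by auto
      then show "X \<in> tr (inv_into UNIV f) ` T" by (metis imageI)
    qed
    from T(2) obtain Y where Y: "Y \<in> T" "Y \<notin> tr f ` S" by blast
    have "tr f (tr (inv_into UNIV f) Y) = Y" using Y Tc tr_tr_inv[OF f] by auto
    then have "tr (inv_into UNIV f) Y \<notin> S" using Y by (metis imageI)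
    then show "S \<noteq> tr (inv_into UNIV f) ` T" using Y by blast
  qed
  ultimately show False using S by (auto simp: maximal_set_def)
qed

text \<open>As \<open>f\<close> reverses products, \<open>x i * v j\<close> becomes
  \<open>f (v j) * f (x i)\<close>: the fixed column turns into a fixed row.\<close>

lemma tr_row_set:
  assumes f: "anti_iso f" and A: "A \<in> carrier_mat m n"
  shows "tr f ` row_set m n A x = col_set n m (tr f A) (\<lambda>i. f (x i))"
proof (intro Set.set_eqI iffI)
  have f': "f (a + b) = f a + f b" "f (a * b) = f b * f a" for a b using f by (auto simp: anti_iso_def)
  fix Y
  {
    assume "Y \<in> tr f ` row_set m n A x"
    then obtain X where X: "Y = tr f X" "X \<in> row_set m n A x" by blast
    from X(2) obtain v where v: "X \<in> carrier_mat m n"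
      "\<forall>i<m. \<forall>j<n. X $$ (i, j) = A $$ (i, j) + x i * v j" by (rule row_setE) blast
    then show "Y \<in> col_set n m (tr f A) (\<lambda>i. f (x i))" unfolding X(1)
      by (intro col_setI[where w = "\<lambda>j. f (v j)"]) (simp_all add: tr_index[OF v(1)] tr_index[OF A] f')
  next
    assume "Y \<in> col_set n m (tr f A) (\<lambda>i. f (x i))"
    then obtain w where w: "Y \<in> carrier_mat n m"
      "\<forall>i<n. \<forall>j<m. Y $$ (i, j) = tr f A $$ (i, j) + w i * f (x j)"
      by (rule col_setE) blast
    note g = anti_iso_inv[OF f]
    have g': "inv_into UNIV f (a + b) = inv_into UNIV f a + inv_into UNIV f b" "inv_into UNIV f (a * b) = inv_into UNIV f b * inv_into UNIV f a" for a b
      using g by (auto simp: anti_iso_def)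
    have gf: "inv_into UNIV f (f a) = a" for a using f by (simp add: anti_iso_def bij_is_inj)
    have "tr (inv_into UNIV f) Y \<in> row_set m n A x"
      using w by (intro row_setI[where v = "\<lambda>j. inv_into UNIV f (w j)"])
        (simp_all add: tr_index[OF w(1)] tr_index[OF A] g' gf)
    then show "Y \<in> tr f ` row_set m n A x" using tr_tr_inv[OF f w(1)] by (metis imageI)
  }
qed

lemma tr_col_set:
  assumes f: "anti_iso f" and A: "A \<in> carrier_mat m n"
  shows "tr f ` col_set m n A y = row_set n m (tr f A) (\<lambda>j. f (y j))"
proof -
  have gf: "inv_into UNIV f (f a) = a" for a using f by (simp add: anti_iso_def bij_is_inj)
  let ?R = "row_set n m (tr f A) (\<lambda>j. f (y j))"
  have "tr (inv_into UNIV f) ` ?R = col_set m n A y"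
    using tr_row_set[OF anti_iso_inv[OF f] tr_carrier[OF A], of f "\<lambda>j. f (y j)"]
    by (simp add: tr_inv_tr[OF f A] gf)
  then have "tr f ` col_set m n A y = (\<lambda>X. tr f (tr (inv_into UNIV f) X)) ` ?R" by (metis image_image)
  also have "\<dots> = (\<lambda>X. X) ` ?R"
    by (rule image_cong) (auto simp: row_set_def intro: tr_tr_inv[OF f])
  finally show ?thesis by simp
qed

text \<open>Let \<open>X\<close> outside the set be near all its members, with \<open>X - A\<close>
  the product of \<open>p\<close> and \<open>q\<close>. Comparing \<open>X\<close> with a member
  \<open>?Z\<close> whose column vector is not a right multiple of \<open>p\<close> makes
  \<open>q\<close> a left multiple of \<open>y\<close>, which puts \<open>X\<close> into the
  set.\<close>

lemma maximal_set_col_set: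
  assumes A: "A \<in> carrier_mat m n" and m: "m \<ge> 2" and y: "j0 < n" "y j0 \<noteq> 0"
  shows "maximal_set m n (col_set m n A y)"
  unfolding maximal_set_def
proof (intro conjI notI)
  have Ain: "A \<in> col_set m n A y" by (rule base_in_col_set[OF A])
  have sub: "col_set m n A y \<subseteq> carrier_mat m n" by (auto simp: col_set_def)
  have nr0: "near m n X Y" if XY: "X \<in> col_set m n A y" "Y \<in> col_set m n A y" for X Y
  proof -
    from XY(2) have "Y \<in> col_set m n X y" unfolding col_set_rebase[OF XY(1)] .
    then show ?thesis by (rule col_setE) (unfold near_def, intro exI)
  qed
  show "adjacent_set m n (col_set m n A y)"
    unfolding adjacent_set_def
  proof (intro conjI ballI impI)
    show "col_set m n A y \<noteq> {}" using Ain by blast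
    show "col_set m n A y \<subseteq> carrier_mat m n" by (rule sub)
    fix X Y assume XY: "X \<in> col_set m n A y" "Y \<in> col_set m n A y" "X \<noteq> Y"
    then show "adjacent X Y" using nr0 sub adjacent_iff[of X m n Y] by blast
  qed
  assume "\<exists>T. adjacent_set m n T \<and> col_set m n A y \<subset> T"
  then obtain T X where T: "adjacent_set m n T" "col_set m n A y \<subseteq> T" and X: "X \<in> T" "X \<notin> col_set m n A y"
    by blast
  have Xc: "X \<in> carrier_mat m n" using T(1) X(1) unfolding adjacent_set_def by blast
  have nr: "near m n Z X" if "Z \<in> col_set m n A y" for Z
  proof (cases "Z = X")
    case False
    then have "adjacent Z X" using that X(1) T unfolding adjacent_set_def by blast
    then show ?thesis using adjacent_iff[of Z m n X] sub that Xc by blast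
  qed (simp add: near_refl)
  from nr[OF Ain] obtain p q where pq: "\<forall>i<m. \<forall>j<n. X $$ (i, j) = A $$ (i, j) + p i * q j"
    by (rule nearE)
  have "\<exists>i0<m. p i0 \<noteq> 0"
  proof (rule ccontr)
    assume "\<not> ?thesis"
    then have "X \<in> col_set m n A y" using Xc pq by (intro col_setI[where w = p]) simp_all
    with X show False by simp
  qed
  then obtain i0 where i0: "i0 < m" "p i0 \<noteq> 0" by blast
  \<comment> \<open>A row index other than \<open>i0\<close>, available because
    \<open>m \<ge> 2\<close>. The unit vector at \<open>k\<close> vanishes at \<open>i0\<close>,
    where \<open>p\<close> does not, so it is no right multiple of \<open>p\<close>.\<close>
  define k where "k = (if i0 = 0 then 1 else 0 :: nat)"
  have k: "k < m" "k \<noteq> i0" using m by (auto simp: k_def)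
  define w where "w i = (if i = k then 1 else 0 :: 'a)" for i
  let ?Z = "mat m n (\<lambda>(i, j). A $$ (i, j) + w i * y j)"
  have "?Z \<in> col_set m n A y" by (rule col_setI[where w = w]) simp_all
  from nr[OF this] obtain s t where st: "\<forall>i<m. \<forall>j<n. X $$ (i, j) = ?Z $$ (i, j) + s i * t j"
    by (rule nearE)
  have "p i * q j + - w i * y j = s i * t j" if "i < m" "j < n" for i j
    using pq[rule_format, OF that] st[rule_format, OF that] that by (simp add: algebra_simps)
  from rank_one_sum[of m n p q "\<lambda>i. - w i" y s t i0 j0, OF this i0 y]
  consider l where "\<forall>i<m. - w i = p i * l" | l where "\<forall>j<n. q j = l * y j" by metis
  then show False
  proof cases
    case 1
    then have "- w i0 = p i0 * l" "- w k = p k * l" using i0 k by auto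
    then show False using i0 k by (auto simp: w_def)
  next
    case 2
    then have "X \<in> col_set m n A y"
      using Xc pq by (intro col_setI[where w = "\<lambda>i. p i * l"]) (simp_all add: mult.assoc)
    with X show False by simp
  qed
qed

section \<open>The opposite division ring\<close>

typedef 'a opp = "UNIV :: 'a set" morphisms of_opp Opp ..

setup_lifting type_definition_opp

instantiation opp :: (division_ring) division_ring
begin

lift_definition zero_opp :: "'a opp" is 0 .
lift_definition one_opp :: "'a opp" is 1 .
lift_definition plus_opp :: "'a opp \<Rightarrow> 'a opp \<Rightarrow> 'a opp" is "(+)" .
lift_definition minus_opp :: "'a opp \<Rightarrow> 'a opp \<Rightarrow> 'a opp" is "(-)" .
lift_definition uminus_opp :: "'a opp \<Rightarrow> 'a opp" is uminus .
lift_definition times_opp :: "'a opp \<Rightarrow> 'a opp \<Rightarrow> 'a opp" is "\<lambda>a b. b * a" .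
lift_definition inverse_opp :: "'a opp \<Rightarrow> 'a opp" is inverse .
lift_definition divide_opp :: "'a opp \<Rightarrow> 'a opp \<Rightarrow> 'a opp" is "\<lambda>a b. inverse b * a" .

instance
  by standard (transfer; simp add: algebra_simps)+

end

text \<open>On elements \<open>Opp\<close> is the identity and only the product is reversed. Hence
  every division ring admits an anti-isomorphism onto a division ring, and transposition is always
  available.\<close>

lemma anti_iso_Opp: "anti_iso Opp"
  unfolding anti_iso_def
proof (intro conjI allI)
  show "bij Opp" by (rule bijI') (auto simp: Opp_inject intro: Opp_cases)
qed (transfer, simp)+

lemma anti_iso_sum: "anti_iso f \<Longrightarrow> f (sum g S) = (\<Sum>i\<in>S. f (g i))"
  by (induction S rule: infinite_finite_induct) (auto simp: anti_iso_zero anti_iso_def)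

lemma mult_index:
  assumes "A \<in> carrier_mat m k" "B \<in> carrier_mat k n" "i < m" "j < n"
  shows "(A * B) $$ (i, j) = (\<Sum>l<k. A $$ (i, l) * B $$ (l, j))"
  using assms by (auto simp: scalar_prod_def lessThan_atLeast0)

lemma tr_mult:
  assumes f: "anti_iso f" and A: "A \<in> carrier_mat m k" and B: "B \<in> carrier_mat k n"
  shows "tr f (A * B) = tr f B * tr f A"
proof (rule eq_matI)
  have AB: "A * B \<in> carrier_mat m n" using A B by simp
  fix i j assume "i < dim_row (tr f B * tr f A)" "j < dim_col (tr f B * tr f A)"
  then have ij: "i < n" "j < m" using A B by (auto simp: tr_def)
  have "tr f (A * B) $$ (i, j) = (\<Sum>l<k. f (A $$ (j, l) * B $$ (l, i)))"
    unfolding tr_index[OF AB ij] mult_index[OF A B ij(2,1)] by (rule anti_iso_sum[OF f])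
  also have "\<dots> = (\<Sum>l<k. tr f B $$ (i, l) * tr f A $$ (l, j))"
    using f ij by (intro sum.cong) (simp_all add: tr_index[OF A] tr_index[OF B] anti_iso_def)
  also have "\<dots> = (tr f B * tr f A) $$ (i, j)"
    using mult_index[OF tr_carrier[OF B, of f] tr_carrier[OF A, of f] ij] by simp
  finally show "tr f (A * B) $$ (i, j) = (tr f B * tr f A) $$ (i, j)" .
qed (use A B in \<open>auto simp: tr_def\<close>)

lemma tr_one: "anti_iso f \<Longrightarrow> tr f (1\<^sub>m n) = 1\<^sub>m n"
  by (rule eq_matI) (auto simp: tr_def anti_iso_zero anti_iso_one)

text \<open>The dimensions of the inverse are read off the two identities for the products.\<close>

lemma invertible_matE:
  assumes "invertible_mat P" "P \<in> carrier_mat m m"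
  obtains B where "B \<in> carrier_mat m m" "P * B = 1\<^sub>m m" "B * P = 1\<^sub>m m"
proof -
  from assms obtain B where B: "P * B = 1\<^sub>m m" "B * P = 1\<^sub>m (dim_row B)"
    by (auto simp: invertible_mat_def inverts_mat_def)
  have "dim_col (P * B) = m" "dim_col (B * P) = dim_row B" unfolding B by simp_all
  then have "B \<in> carrier_mat m m" using assms(2) by auto
  with B that show ?thesis by auto
qed

lemma invertible_matI:
  assumes "P \<in> carrier_mat m m" "B \<in> carrier_mat m m" "P * B = 1\<^sub>m m" "B * P = 1\<^sub>m m"
  shows "invertible_mat P"
  using assms by (auto simp: invertible_mat_def inverts_mat_def intro!: exI[of _ B])

lemma invertible_tr:
  assumes f: "anti_iso f" and P: "P \<in> carrier_mat m m" and inv: "invertible_mat P"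
  shows "invertible_mat (tr f P)"
proof -
  from inv P obtain B where B: "B \<in> carrier_mat m m" "P * B = 1\<^sub>m m" "B * P = 1\<^sub>m m"
    by (rule invertible_matE)
  show ?thesis
    by (rule invertible_matI[OF tr_carrier[OF P] tr_carrier[OF B(1), of f]])
      (simp_all add: tr_mult[OF f P B(1), symmetric] tr_mult[OF f B(1) P, symmetric] B tr_one[OF f])
qed

section \<open>Completing a nonzero vector to an invertible matrix\<close>

lemma ex_invertible_first_row:
  fixes y :: "nat \<Rightarrow> 'a::division_ring"
  assumes k: "k < n" "y k \<noteq> 0"
  shows "\<exists>Q\<in>carrier_mat n n. invertible_mat Q \<and> (\<forall>j<n. Q $$ (0, j) = y j)"
proof -
  \<comment> \<open>\<open>Q\<close> is the permutation matrix of the transposition of \<open>0\<close> and \<open>k\<close> with its first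
    row replaced by \<open>y\<close>, and \<open>R\<close> is its inverse\<close>
  define \<tau> where "\<tau> i = (if i = 0 then k else if i = k then 0 else i)" for i
  have \<tau>: "\<tau> (\<tau> i) = i" "\<tau> i = k \<longleftrightarrow> i = 0" "\<tau> i = 0 \<longleftrightarrow> i = k" for i
    by (auto simp: \<tau>_def)
  have \<tau>n: "\<tau> i < n" if "i < n" for i using that k by (auto simp: \<tau>_def)
  have swap: "j = \<tau> i \<longleftrightarrow> i = \<tau> j" for i j using \<tau>(1) by metis
  define Q where "Q = mat n n (\<lambda>(i, j). if i = 0 then y j else if j = \<tau> i then 1 else 0)"
  define R where "R = mat n n (\<lambda>(i, j). if i \<noteq> k then (if j = \<tau> i then 1 else 0)
     else if j = 0 then inverse (y k) else - (inverse (y k) * y (\<tau> j)))"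
  have Qc: "Q \<in> carrier_mat n n" and Rc: "R \<in> carrier_mat n n" by (auto simp: Q_def R_def)
  have n0: "0 < n" using k by simp
  have "Q * R = 1\<^sub>m n"
  proof (rule eq_matI)
    fix i j assume "i < dim_row (1\<^sub>m n :: 'a mat)" "j < dim_col (1\<^sub>m n :: 'a mat)"
    then have ij: "i < n" "j < n" by auto
    note mult = mult_index[OF Qc Rc ij]
    have "(\<Sum>l<n. Q $$ (i, l) * R $$ (l, j)) = (if i = j then 1 else 0)"
    proof (cases "i = 0")
      case False
      \<comment> \<open>Row \<open>i\<close> of \<open>Q\<close> has its only nonzero entry in
        column \<open>\<tau> i\<close>, so it selects one row of \<open>R\<close>.\<close>
      have "(\<Sum>l<n. Q $$ (i, l) * R $$ (l, j)) = (\<Sum>l<n. if l = \<tau> i then R $$ (l, j) else 0)"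
        using ij False by (intro sum.cong) (auto simp: Q_def)
      also have "\<dots> = R $$ (\<tau> i, j)" using \<tau>n[OF ij(1)] by simp
      also have "\<dots> = (if i = j then 1 else 0)" using ij False \<tau>n[OF ij(1)] by (auto simp: R_def \<tau>)
      finally show ?thesis .
    next
      case True
      \<comment> \<open>The exceptional row \<open>k\<close> of \<open>R\<close> is split off; its
        entry cancels the value \<open>y (\<tau> j)\<close> contributed by the permutation
        part.\<close>
      have "(\<Sum>l<n. Q $$ (i, l) * R $$ (l, j)) = y k * R $$ (k, j) + (\<Sum>l\<in>{..<n}-{k}. y l * R $$ (l, j))"
        using True ij k n0 by (subst sum.remove[of _ k]) (auto simp: Q_def)
      also have "(\<Sum>l\<in>{..<n}-{k}. y l * R $$ (l, j)) = (\<Sum>l\<in>{..<n}-{k}. if l = \<tau> j then y l else 0)"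
        using ij by (intro sum.cong) (auto simp: R_def swap[of j])
      also have "\<dots> = (if j = 0 then 0 else y (\<tau> j))" using \<tau>n[OF ij(2)] by (auto simp: \<tau>)
      also have "y k * R $$ (k, j) + \<dots> = (if i = j then 1 else 0)"
        using True ij k by (auto simp: R_def mult.assoc[symmetric])
      finally show ?thesis .
    qed
    then show "(Q * R) $$ (i, j) = 1\<^sub>m n $$ (i, j)" using mult ij by simp
  qed (use Qc Rc in auto)
  moreover have "R * Q = 1\<^sub>m n"
  proof (rule eq_matI)
    fix i j assume "i < dim_row (1\<^sub>m n :: 'a mat)" "j < dim_col (1\<^sub>m n :: 'a mat)"
    then have ij: "i < n" "j < n" by auto
    note mult = mult_index[OF Rc Qc ij]
    have "(\<Sum>l<n. R $$ (i, l) * Q $$ (l, j)) = (if i = j then 1 else 0)"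
    proof (cases "i = k")
      case False
      have "(\<Sum>l<n. R $$ (i, l) * Q $$ (l, j)) = (\<Sum>l<n. if l = \<tau> i then Q $$ (l, j) else 0)"
        using ij False by (intro sum.cong) (auto simp: R_def)
      also have "\<dots> = Q $$ (\<tau> i, j)" using \<tau>n[OF ij(1)] by simp
      also have "\<dots> = (if i = j then 1 else 0)" using ij False \<tau>n[OF ij(1)] by (auto simp: Q_def \<tau>)
      finally show ?thesis .
    next
      case True
      have "(\<Sum>l<n. R $$ (i, l) * Q $$ (l, j)) =
          inverse (y k) * y j + (\<Sum>l\<in>{..<n}-{0}. - (inverse (y k) * y (\<tau> l)) * Q $$ (l, j))"
        using True ij k n0 by (subst sum.remove[of _ 0]) (auto simp: Q_def R_def)
      also have "(\<Sum>l\<in>{..<n}-{0}. - (inverse (y k) * y (\<tau> l)) * Q $$ (l, j)) =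
          (\<Sum>l\<in>{..<n}-{0}. if l = \<tau> j then - (inverse (y k) * y j) else 0)"
        using ij by (intro sum.cong) (auto simp: Q_def swap[of j] \<tau>(1))
      also have "\<dots> = (if j = k then 0 else - (inverse (y k) * y j))" using \<tau>n[OF ij(2)] by (auto simp: \<tau>)
      also have "inverse (y k) * y j + \<dots> = (if i = j then 1 else 0)" using True k by auto
      finally show ?thesis .
    qed
    then show "(R * Q) $$ (i, j) = 1\<^sub>m n $$ (i, j)" using mult ij by simp
  qed (use Qc Rc in auto)
  ultimately have "invertible_mat Q" using invertible_matI[OF Qc Rc] by blast
  moreover have "\<forall>j<n. Q $$ (0, j) = y j" using n0 by (simp add: Q_def)
  ultimately show ?thesis using Qc by blast
qed

text \<open>The row version over the opposite ring, transposed back.\<close>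

lemma ex_invertible_first_col:
  fixes x :: "nat \<Rightarrow> 'a::division_ring"
  assumes k: "k < m" "x k \<noteq> 0"
  shows "\<exists>P\<in>carrier_mat m m. invertible_mat P \<and> (\<forall>i<m. P $$ (i, 0) = x i)"
proof -
  note g = anti_iso_inv[OF anti_iso_Opp]
  have gO: "inv_into UNIV Opp (Opp a) = a" for a :: 'a
    using anti_iso_Opp[where 'a = 'a] by (simp add: anti_iso_def bij_is_inj)
  have "Opp (x k) \<noteq> 0" using k by (simp add: zero_opp_def Opp_inject)
  from ex_invertible_first_row[of k m "\<lambda>i. Opp (x i)", OF k(1) this]
  obtain Q where Q: "Q \<in> carrier_mat m m" "invertible_mat Q" "\<forall>j<m. Q $$ (0, j) = Opp (x j)" by blast
  have "\<forall>i<m. tr (inv_into UNIV Opp) Q $$ (i, 0) = x i" using Q(3) k by (auto simp: tr_index[OF Q(1)] gO)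
  then show ?thesis using invertible_tr[OF g Q(1,2)] tr_carrier[OF Q(1)] by blast
qed

section \<open>The two types of maximal sets as row sets and column sets\<close>

lemma first_row_mult:
  assumes "X \<in> first_row_mats m n" "P \<in> carrier_mat m m" "i < m" "j < n"
  shows "(P * X) $$ (i, j) = P $$ (i, 0) * X $$ (0, j)"
proof -
  have X: "X \<in> carrier_mat m n" "\<And>l. l < m \<Longrightarrow> l \<noteq> 0 \<Longrightarrow> X $$ (l, j) = 0"
    using assms by (auto simp: first_row_mats_def)
  have "(P * X) $$ (i, j) = (\<Sum>l<m. P $$ (i, l) * X $$ (l, j))"
    by (rule mult_index[OF assms(2) X(1) assms(3,4)])
  also have "\<dots> = (\<Sum>l<m. if l = 0 then P $$ (i, 0) * X $$ (0, j) else 0)"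
    using X(2) by (intro sum.cong) auto
  finally show ?thesis using assms(3) by simp
qed

lemma first_col_mult:
  assumes "X \<in> first_col_mats m n" "Q \<in> carrier_mat n n" "i < m" "j < n"
  shows "(X * Q) $$ (i, j) = X $$ (i, 0) * Q $$ (0, j)"
proof -
  have X: "X \<in> carrier_mat m n" "\<And>l. l < n \<Longrightarrow> l \<noteq> 0 \<Longrightarrow> X $$ (i, l) = 0"
    using assms by (auto simp: first_col_mats_def)
  have "(X * Q) $$ (i, j) = (\<Sum>l<n. X $$ (i, l) * Q $$ (l, j))"
    by (rule mult_index[OF X(1) assms(2) assms(3,4)])
  also have "\<dots> = (\<Sum>l<n. if l = 0 then X $$ (i, 0) * Q $$ (0, j) else 0)"
    using X(2) by (intro sum.cong) auto
  finally show ?thesis using assms(4) by simp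
qed

lemma image_first_row_mats:
  assumes P: "P \<in> carrier_mat m m" and A: "A \<in> carrier_mat m n" and m: "0 < m"
  shows "(\<lambda>X. P * X + A) ` first_row_mats m n = row_set m n A (\<lambda>i. P $$ (i, 0))"
proof (intro Set.set_eqI iffI)
  fix Y assume "Y \<in> (\<lambda>X. P * X + A) ` first_row_mats m n"
  then obtain X where X: "X \<in> first_row_mats m n" "Y = P * X + A" by blast
  have Xc: "X \<in> carrier_mat m n" using X by (simp add: first_row_mats_def)
  show "Y \<in> row_set m n A (\<lambda>i. P $$ (i, 0))"
    using P A Xc first_row_mult[OF X(1) P] unfolding X(2)
    by (intro row_setI[where v = "\<lambda>j. X $$ (0, j)"]) (simp_all add: add.commute del: index_mult_mat(1))
next
  fix Y assume "Y \<in> row_set m n A (\<lambda>i. P $$ (i, 0))"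
  then obtain v where v: "Y \<in> carrier_mat m n" "\<forall>i<m. \<forall>j<n. Y $$ (i, j) = A $$ (i, j) + P $$ (i, 0) * v j"
    by (rule row_setE)
  define X where "X = mat m n (\<lambda>(i, j). if i = 0 then v j else 0)"
  have X: "X \<in> first_row_mats m n" by (auto simp: X_def first_row_mats_def)
  have Xc: "X \<in> carrier_mat m n" by (simp add: X_def)
  have "Y = P * X + A"
  proof (rule eq_matI)
    fix i j assume "i < dim_row (P * X + A)" "j < dim_col (P * X + A)"
    then have ij: "i < m" "j < n" using A by auto
    then show "Y $$ (i, j) = (P * X + A) $$ (i, j)"
      using A P Xc m v(2) first_row_mult[OF X P ij]
      by (simp add: X_def add.commute del: index_mult_mat(1))
  qed (use v(1) A in auto)
  with X show "Y \<in> (\<lambda>X. P * X + A) ` first_row_mats m n" by blast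
qed

lemma image_first_col_mats:
  assumes Q: "Q \<in> carrier_mat n n" and A: "A \<in> carrier_mat m n" and n: "0 < n"
  shows "(\<lambda>X. X * Q + A) ` first_col_mats m n = col_set m n A (\<lambda>j. Q $$ (0, j))"
proof (intro Set.set_eqI iffI)
  fix Y assume "Y \<in> (\<lambda>X. X * Q + A) ` first_col_mats m n"
  then obtain X where X: "X \<in> first_col_mats m n" "Y = X * Q + A" by blast
  have Xc: "X \<in> carrier_mat m n" using X by (simp add: first_col_mats_def)
  show "Y \<in> col_set m n A (\<lambda>j. Q $$ (0, j))"
    using Q A Xc first_col_mult[OF X(1) Q] unfolding X(2)
    by (intro col_setI[where w = "\<lambda>i. X $$ (i, 0)"]) (simp_all add: add.commute del: index_mult_mat(1))
next
  fix Y assume "Y \<in> col_set m n A (\<lambda>j. Q $$ (0, j))"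
  then obtain w where w: "Y \<in> carrier_mat m n" "\<forall>i<m. \<forall>j<n. Y $$ (i, j) = A $$ (i, j) + w i * Q $$ (0, j)"
    by (rule col_setE)
  define X where "X = mat m n (\<lambda>(i, j). if j = 0 then w i else 0)"
  have X: "X \<in> first_col_mats m n" by (auto simp: X_def first_col_mats_def)
  have Xc: "X \<in> carrier_mat m n" by (simp add: X_def)
  have "Y = X * Q + A"
  proof (rule eq_matI)
    fix i j assume "i < dim_row (X * Q + A)" "j < dim_col (X * Q + A)"
    then have ij: "i < m" "j < n" using A by auto
    then show "Y $$ (i, j) = (X * Q + A) $$ (i, j)"
      using A Q Xc n w(2) first_col_mult[OF X Q ij]
      by (simp add: X_def add.commute del: index_mult_mat(1))
  qed (use w(1) A in auto)
  with X show "Y \<in> (\<lambda>X. X * Q + A) ` first_col_mats m n" by blast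
qed

text \<open>The column case over the opposite ring, with the transposition undone
  afterwards.\<close>

lemma maximal_set_row_set:
  fixes A :: "'a::division_ring mat"
  assumes A: "A \<in> carrier_mat m n" and n: "n \<ge> 2" and x: "i0 < m" "x i0 \<noteq> 0"
  shows "maximal_set m n (row_set m n A x)"
proof -
  note f = anti_iso_Opp[where 'a = 'a]
  have "Opp (x i0) \<noteq> 0" using x by (simp add: zero_opp_def Opp_inject)
  then have "maximal_set n m (tr Opp ` row_set m n A x)"
    unfolding tr_row_set[OF f A] by (intro maximal_set_col_set[where ?j0.0 = i0] tr_carrier A n x(1))
  from maximal_set_tr[OF anti_iso_inv[OF f] this]
  have "maximal_set m n ((\<lambda>X. tr (inv_into UNIV Opp) (tr Opp X)) ` row_set m n A x)"
    by (simp add: image_image)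
  also have "(\<lambda>X. tr (inv_into UNIV Opp) (tr Opp X)) ` row_set m n A x = (\<lambda>X. X) ` row_set m n A x"
    by (rule image_cong) (auto simp: row_set_def intro: tr_inv_tr[OF f])
  finally show ?thesis by simp
qed

text \<open>The first column of an invertible \<open>P\<close> is nonzero, as otherwise
  \<open>B * P\<close> would have a zero in its corner; conversely a nonzero \<open>x\<close> is
  completed to an invertible matrix.\<close>

lemma maximal_type_one_iff:
  assumes m: "m \<ge> 2" and n: "n \<ge> 2"
  shows "maximal_type_one m n S \<longleftrightarrow>
    (\<exists>A\<in>carrier_mat m n. \<exists>x. (\<exists>i<m. x i \<noteq> 0) \<and> S = row_set m n A x)"
proof
  assume "maximal_type_one m n S"
  then obtain P A where P: "P \<in> carrier_mat m m" "A \<in> carrier_mat m n" "invertible_mat P"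
    and S: "S = (\<lambda>X. P * X + A) ` first_row_mats m n" by (auto simp: maximal_type_one_def)
  from P(3,1) obtain B where B: "B \<in> carrier_mat m m" "P * B = 1\<^sub>m m" "B * P = 1\<^sub>m m"
    by (rule invertible_matE)
  have "\<exists>i<m. P $$ (i, 0) \<noteq> 0"
  proof (rule ccontr)
    assume "\<not> ?thesis"
    then have "(B * P) $$ (0, 0) = 0" using m by (subst mult_index[OF B(1) P(1)]) auto
    then show False using m unfolding B(3) by simp
  qed
  moreover have "S = row_set m n A (\<lambda>i. P $$ (i, 0))"
    unfolding S using image_first_row_mats[OF P(1,2)] m by simp
  ultimately show "\<exists>A\<in>carrier_mat m n. \<exists>x. (\<exists>i<m. x i \<noteq> 0) \<and> S = row_set m n A x"
    using P(2) by (intro bexI[of _ A] exI[of _ "\<lambda>i. P $$ (i, 0)"]) auto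
next
  assume "\<exists>A\<in>carrier_mat m n. \<exists>x. (\<exists>i<m. x i \<noteq> 0) \<and> S = row_set m n A x"
  then obtain A x i0 where A: "A \<in> carrier_mat m n" and x: "i0 < m" "x i0 \<noteq> 0"
    and S: "S = row_set m n A x" by blast
  from ex_invertible_first_col[of i0 m x, OF x] obtain P where P: "P \<in> carrier_mat m m" "invertible_mat P"
    "\<forall>i<m. P $$ (i, 0) = x i" by blast
  have "row_set m n A (\<lambda>i. P $$ (i, 0)) = row_set m n A x" using P(3) by (simp add: row_set_def)
  then have SP: "S = (\<lambda>X. P * X + A) ` first_row_mats m n"
    using image_first_row_mats[OF P(1) A] m S by simp
  have "maximal_set m n S"
    unfolding S using x by (intro maximal_set_row_set[where x = x] A n)
  then show "maximal_type_one m n S"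
    unfolding maximal_type_one_def using P(2) SP
    by (intro conjI bexI[OF _ P(1)] bexI[OF _ A])
qed

lemma maximal_type_two_iff:
  assumes m: "m \<ge> 2" and n: "n \<ge> 2"
  shows "maximal_type_two m n S \<longleftrightarrow>
    (\<exists>A\<in>carrier_mat m n. \<exists>y. (\<exists>j<n. y j \<noteq> 0) \<and> S = col_set m n A y)"
proof
  assume "maximal_type_two m n S"
  then obtain Q A where Q: "Q \<in> carrier_mat n n" "A \<in> carrier_mat m n" "invertible_mat Q"
    and S: "S = (\<lambda>X. X * Q + A) ` first_col_mats m n" by (auto simp: maximal_type_two_def)
  from Q(3,1) obtain B where B: "B \<in> carrier_mat n n" "Q * B = 1\<^sub>m n" "B * Q = 1\<^sub>m n"
    by (rule invertible_matE)
  have "\<exists>j<n. Q $$ (0, j) \<noteq> 0"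
  proof (rule ccontr)
    assume "\<not> ?thesis"
    then have "(Q * B) $$ (0, 0) = 0" using n by (subst mult_index[OF Q(1) B(1)]) auto
    then show False using n unfolding B(2) by simp
  qed
  moreover have "S = col_set m n A (\<lambda>j. Q $$ (0, j))"
    unfolding S using image_first_col_mats[OF Q(1,2)] n by simp
  ultimately show "\<exists>A\<in>carrier_mat m n. \<exists>y. (\<exists>j<n. y j \<noteq> 0) \<and> S = col_set m n A y"
    using Q(2) by (intro bexI[of _ A] exI[of _ "\<lambda>j. Q $$ (0, j)"]) auto
next
  assume "\<exists>A\<in>carrier_mat m n. \<exists>y. (\<exists>j<n. y j \<noteq> 0) \<and> S = col_set m n A y"
  then obtain A y j0 where A: "A \<in> carrier_mat m n" and y: "j0 < n" "y j0 \<noteq> 0"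
    and S: "S = col_set m n A y" by blast
  from ex_invertible_first_row[of j0 n y, OF y] obtain Q where Q: "Q \<in> carrier_mat n n" "invertible_mat Q"
    "\<forall>j<n. Q $$ (0, j) = y j" by blast
  have "col_set m n A (\<lambda>j. Q $$ (0, j)) = col_set m n A y" using Q(3) by (simp add: col_set_def)
  then have SQ: "S = (\<lambda>X. X * Q + A) ` first_col_mats m n"
    using image_first_col_mats[OF Q(1) A] n S by simp
  have "maximal_set m n S"
    unfolding S using y by (intro maximal_set_col_set[where y = y] A m)
  then show "maximal_type_two m n S"
    unfolding maximal_type_two_def using Q(2) SQ
    by (intro conjI bexI[OF _ Q(1)] bexI[OF _ A])
qed

subsection \<open>Neighbours of maximal sets\<close>

text \<open>The difference of \<open>Q\<close> and \<open>P\<close> is, up to sign, \<open>x\<close>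
  times \<open>v\<close> minus \<open>w\<close> times \<open>y\<close>. If its rank is at most one,
  \<open>rank_one_sum\<close> makes \<open>w\<close> a right multiple of \<open>x\<close> or
  \<open>v\<close> a left multiple of \<open>y\<close>.\<close>

lemma near_row_col:
  assumes x: "i0 < m" "x i0 \<noteq> 0" and y: "j0 < n" "y j0 \<noteq> 0"
    and P: "P \<in> row_set m n O1 x" and Q: "Q \<in> col_set m n O1 y" and near: "near m n P Q"
  shows "P \<in> col_set m n O1 y \<or> Q \<in> row_set m n O1 x"
proof -
  from P obtain v where v: "P \<in> carrier_mat m n" "\<forall>i<m. \<forall>j<n. P $$ (i, j) = O1 $$ (i, j) + x i * v j"
    by (rule row_setE)
  from Q obtain w where w: "Q \<in> carrier_mat m n" "\<forall>i<m. \<forall>j<n. Q $$ (i, j) = O1 $$ (i, j) + w i * y j"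
    by (rule col_setE)
  from near obtain s t where st: "\<forall>i<m. \<forall>j<n. Q $$ (i, j) = P $$ (i, j) + s i * t j" by (rule nearE)
  have "x i * v j + - w i * y j = - s i * t j" if "i < m" "j < n" for i j
    using v(2)[rule_format, OF that] w(2)[rule_format, OF that] st[rule_format, OF that]
    by (simp add: algebra_simps)
  from rank_one_sum[of m n x v "\<lambda>i. - w i" y "\<lambda>i. - s i" t i0 j0, OF this x y]
  consider l where "\<forall>i<m. - w i = x i * l" | l where "\<forall>j<n. v j = l * y j" by metis
  then show ?thesis
  proof cases
    case 1
    then have "w i = x i * - l" if "i < m" for i using that by (metis minus_minus mult_minus_right)
    then have "Q \<in> row_set m n O1 x"
      using w by (intro row_setI[where v = "\<lambda>j. - l * y j"]) (simp_all add: mult.assoc)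
    then show ?thesis ..
  next
    case 2
    then have "P \<in> col_set m n O1 y"
      using v by (intro col_setI[where w = "\<lambda>i. x i * l"]) (simp_all add: mult.assoc)
    then show ?thesis ..
  qed
qed

text \<open>Two distinct points of the intersection differ by \<open>x i * l * y j\<close> with
  \<open>l \<noteq> 0\<close>. Adding the rank one difference from \<open>Q\<close> to
  \<open>Z\<close> gives rank at most one again, so by \<open>rank_one_sum'\<close> that difference
  has direction \<open>x\<close> or \<open>y\<close>.\<close>

lemma near_two_meet:
  assumes x: "i0 < m" "x i0 \<noteq> 0" and y: "j0 < n" "y j0 \<noteq> 0" and Z: "Z \<in> carrier_mat m n"
    and P: "P \<in> row_set m n O1 x" "P \<in> col_set m n O1 y"
    and Q: "Q \<in> row_set m n O1 x" "Q \<in> col_set m n O1 y"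
    and ne: "P \<noteq> Q" and nP: "near m n P Z" and nQ: "near m n Q Z"
  shows "Z \<in> row_set m n O1 x \<or> Z \<in> col_set m n O1 y"
proof -
  have Qx: "Q \<in> row_set m n P x" using Q(1) unfolding row_set_rebase[OF P(1)] .
  have Qy: "Q \<in> col_set m n P y" using Q(2) unfolding col_set_rebase[OF P(2)] .
  from Qx obtain v where Qc: "Q \<in> carrier_mat m n"
    and v: "\<forall>i<m. \<forall>j<n. Q $$ (i, j) = P $$ (i, j) + x i * v j" by (rule row_setE)
  from Qy obtain w where w: "\<forall>i<m. \<forall>j<n. Q $$ (i, j) = P $$ (i, j) + w i * y j" by (rule col_setE)
  have Pc: "P \<in> carrier_mat m n" using P(1) by (rule row_setE)
  \<comment> \<open>Obtained by solving \<open>x i0 * v j = w i0 * y j\<close> for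
    \<open>v j\<close>.\<close>
  define l where "l = inverse (x i0) * w i0"
  have vw: "x i * v j = w i * y j" if "i < m" "j < n" for i j
    using v w that by (metis add_left_cancel)
  have vl: "v j = l * y j" if "j < n" for j
  proof -
    have "x i0 * v j = w i0 * y j" using vw x that by simp
    then have "inverse (x i0) * (x i0 * v j) = inverse (x i0) * (w i0 * y j)" by simp
    then show ?thesis using x by (simp add: l_def mult.assoc[symmetric])
  qed
  have l0: "l \<noteq> 0"
  proof
    assume "l = 0"
    then have "P = Q" using v vl Pc Qc by (intro eq_matI) auto
    with ne show False ..
  qed
  from nP obtain s t where st: "\<forall>i<m. \<forall>j<n. Z $$ (i, j) = P $$ (i, j) + s i * t j" by (rule nearE)
  from nQ obtain s' t' where st': "\<forall>i<m. \<forall>j<n. Z $$ (i, j) = Q $$ (i, j) + s' i * t' j" by (rule nearE)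
  have eq: "x i * l * y j + s' i * t' j = s i * t j" if "i < m" "j < n" for i j
  proof -
    have "P $$ (i, j) + s i * t j = P $$ (i, j) + x i * v j + s' i * t' j"
      using st st' v that by simp
    then show ?thesis using vl[OF that(2)] by (simp add: add.assoc mult.assoc)
  qed
  have "x i0 * l \<noteq> 0" using x l0 by simp
  from rank_one_sum'[of m n "\<lambda>i. x i * l" y s' t' s t i0 j0, OF eq x(1) this y]
  consider k where "\<forall>i<m. s' i = x i * l * k" | k where "\<forall>j<n. t' j = k * y j"
    by metis
  then show ?thesis
  proof cases
    case 1
    then have "Z \<in> row_set m n Q x"
      using Z st' by (intro row_setI[where v = "\<lambda>j. l * k * t' j"]) (simp_all add: mult.assoc)
    then show ?thesis using row_set_rebase[OF Q(1)] by simp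
  next
    case 2
    then have "Z \<in> col_set m n Q y"
      using Z st' by (intro col_setI[where w = "\<lambda>i. s' i * k"]) (simp_all add: mult.assoc)
    then show ?thesis using col_set_rebase[OF Q(2)] by simp
  qed
qed

text \<open>The row \<open>y\<close> comes from the difference \<open>Z - r0\<close>. Since
  \<open>Z\<close> is outside the row set, the column of this difference is not a right multiple of
  \<open>x\<close>, and \<open>rank_one_sum\<close> forces every other neighbour of \<open>Z\<close>
  in the row set to have the same row direction.\<close>

lemma ex_col_set_through_neighbours:
  assumes x: "i0 < m" "x i0 \<noteq> 0" and Z: "Z \<in> carrier_mat m n" "Z \<notin> row_set m n O1 x"
    and r0: "r0 \<in> row_set m n O1 x" "near m n r0 Z"
  obtains y where "\<exists>j<n. y j \<noteq> 0"
    "\<And>r. r \<in> row_set m n O1 x \<Longrightarrow> near m n Z r \<Longrightarrow> r \<in> col_set m n Z y"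
    "\<And>r1 r2 X. \<lbrakk>r1 \<in> row_set m n O1 x; r2 \<in> row_set m n O1 x; r1 \<noteq> r2; near m n Z r1; near m n Z r2;
      X \<in> carrier_mat m n; near m n r1 X; near m n r2 X; near m n Z X\<rbrakk> \<Longrightarrow> X \<in> col_set m n Z y"
proof -
  let ?M = "row_set m n O1 x"
  from r0(2) obtain s t where st: "\<forall>i<m. \<forall>j<n. Z $$ (i, j) = r0 $$ (i, j) + s i * t j" by (rule nearE)
  have s: "\<not> (\<forall>i<m. s i = x i * l)" for l
  proof
    assume "\<forall>i<m. s i = x i * l"
    then have "Z \<in> row_set m n r0 x"
      using Z st by (intro row_setI[where v = "\<lambda>j. l * t j"]) (simp_all add: mult.assoc)
    with Z row_set_rebase[OF r0(1)] show False by simp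
  qed
  have "\<exists>j<n. t j \<noteq> 0"
  proof (rule ccontr)
    assume "\<not> ?thesis"
    then have "Z \<in> row_set m n r0 x"
      using Z st by (intro row_setI[where v = "\<lambda>j. 0"]) simp_all
    with Z row_set_rebase[OF r0(1)] show False by simp
  qed
  then obtain j0 where j0: "j0 < n" "t j0 \<noteq> 0" by blast
  have nbr: "r \<in> col_set m n Z t" if r: "r \<in> ?M" "near m n Z r" for r
  proof -
    from r(1) have "r \<in> row_set m n r0 x" unfolding row_set_rebase[OF r0(1)] .
    then obtain v where v: "r \<in> carrier_mat m n" "\<forall>i<m. \<forall>j<n. r $$ (i, j) = r0 $$ (i, j) + x i * v j"
      by (rule row_setE)
    from r(2) obtain a b where ab: "\<forall>i<m. \<forall>j<n. r $$ (i, j) = Z $$ (i, j) + a i * b j" by (rule nearE)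
    have "x i * v j + - s i * t j = a i * b j" if "i < m" "j < n" for i j
      using st[rule_format, OF that] v(2)[rule_format, OF that] ab[rule_format, OF that]
      by (simp add: algebra_simps)
    from rank_one_sum[of m n x v "\<lambda>i. - s i" t a b i0 j0, OF this x j0]
    consider l where "\<forall>i<m. - s i = x i * l" | l where "\<forall>j<n. v j = l * t j" by metis
    then show ?thesis
    proof cases
      case 1
      then have "\<forall>i<m. s i = x i * - l" by (metis minus_minus mult_minus_right)
      with s show ?thesis by blast
    next
      case 2
      then show ?thesis using v st
        by (intro col_setI[where w = "\<lambda>i. x i * l - s i"]) (simp_all add: left_diff_distrib mult.assoc)
    qed
  qed
  have tri: "X \<in> col_set m n Z t"
    if r1: "r1 \<in> ?M" "near m n Z r1" "near m n r1 X" and r2: "r2 \<in> ?M" "near m n Z r2" "near m n r2 X"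
      and ne: "r1 \<noteq> r2" and X: "X \<in> carrier_mat m n" "near m n Z X" for r1 r2 X
  proof (rule ccontr)
    assume nX: "X \<notin> col_set m n Z t"
    from X(2) obtain a b where ab: "\<forall>i<m. \<forall>j<n. X $$ (i, j) = Z $$ (i, j) + a i * b j" by (rule nearE)
    have "\<exists>i<m. a i \<noteq> 0"
    proof (rule ccontr)
      assume "\<not> ?thesis"
      then have "X \<in> col_set m n Z t" using X(1) ab by (intro col_setI[where w = "\<lambda>i. 0"]) simp_all
      with nX show False ..
    qed
    then obtain i1 where i1: "i1 < m" "a i1 \<noteq> 0" by blast
    \<comment> \<open>As \<open>X\<close> is off the column set, \<open>b\<close> is not a left
      multiple of \<open>t\<close>; so being near \<open>X\<close> forces \<open>r - Z\<close> to
      have the column direction \<open>a\<close>.\<close>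
    have par: "\<exists>l. \<forall>i<m. \<forall>j<n. r $$ (i, j) = Z $$ (i, j) + a i * l * t j"
      if r: "r \<in> ?M" "near m n Z r" "near m n r X" for r
    proof -
      from nbr[OF r(1,2)] obtain w where w: "\<forall>i<m. \<forall>j<n. r $$ (i, j) = Z $$ (i, j) + w i * t j"
        by (rule col_setE)
      from r(3) obtain c d where cd: "\<forall>i<m. \<forall>j<n. X $$ (i, j) = r $$ (i, j) + c i * d j" by (rule nearE)
      have "a i * b j + - w i * t j = c i * d j" if "i < m" "j < n" for i j
        using w[rule_format, OF that] ab[rule_format, OF that] cd[rule_format, OF that]
        by (simp add: algebra_simps)
      from rank_one_sum[of m n a b "\<lambda>i. - w i" t c d i1 j0, OF this i1 j0]
      consider l where "\<forall>i<m. - w i = a i * l" | l where "\<forall>j<n. b j = l * t j" by metis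
      then show ?thesis
      proof cases
        case 1
        then have "\<forall>i<m. w i = a i * - l" by (metis minus_minus mult_minus_right)
        then show ?thesis using w by (intro exI[of _ "- l"]) simp
      next
        case 2
        then have "X \<in> col_set m n Z t"
          using X(1) ab by (intro col_setI[where w = "\<lambda>i. a i * l"]) (simp_all add: mult.assoc)
        with nX show ?thesis ..
      qed
    qed
    from par[OF r1] obtain l1 where l1: "\<forall>i<m. \<forall>j<n. r1 $$ (i, j) = Z $$ (i, j) + a i * l1 * t j" ..
    from par[OF r2] obtain l2 where l2: "\<forall>i<m. \<forall>j<n. r2 $$ (i, j) = Z $$ (i, j) + a i * l2 * t j" ..
    have r2M: "r2 \<in> row_set m n r1 x" using r2(1) row_set_rebase[OF r1(1)] by simp
    have r1c: "r1 \<in> carrier_mat m n" using r1(1) by (rule row_setE)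
    from r2M obtain v where v: "r2 \<in> carrier_mat m n" "\<forall>i<m. \<forall>j<n. r2 $$ (i, j) = r1 $$ (i, j) + x i * v j"
      by (rule row_setE)
    have "l1 \<noteq> l2"
    proof
      assume "l1 = l2"
      then have "r1 = r2" using l1 l2 r1c v(1) by (intro eq_matI) auto
      with ne show False ..
    qed
    define c where "c = (l2 - l1) * t j0"
    have c0: "c \<noteq> 0" using \<open>l1 \<noteq> l2\<close> j0 by (simp add: c_def)
    \<comment> \<open>The difference \<open>r2 - r1\<close> has column direction \<open>a\<close>
      and also \<open>x\<close>. Thus \<open>a\<close> is a right multiple of \<open>x\<close>, and
      \<open>Z\<close> would lie in the row set.\<close>
    have "a i = x i * (v j0 * inverse c)" if "i < m" for i
    proof -
      have "a i * c = x i * v j0"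
        using l1[rule_format, OF that j0(1)] l2[rule_format, OF that j0(1)] v(2)[rule_format, OF that j0(1)]
        by (simp add: c_def algebra_simps)
      then have "a i * c * inverse c = x i * v j0 * inverse c" by simp
      then show ?thesis using c0 by (simp add: mult.assoc)
    qed
    then have "Z \<in> row_set m n r1 x"
      using Z(1) l1 by (intro row_setI[where v = "\<lambda>j. - (v j0 * inverse c * l1 * t j)"]) (simp_all add: mult.assoc)
    with Z(2) row_set_rebase[OF r1(1)] show False by simp
  qed
  show thesis
  proof (rule that[of t])
    show "\<exists>j<n. t j \<noteq> 0" using j0 by blast
  qed (use nbr tri in blast)+
qed

text \<open>With both sets based at \<open>P\<close>, the nonzero difference \<open>Q - P\<close>
  determines the row direction up to a nonzero left factor.\<close>

lemma col_set_eqI: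
  assumes P: "P \<in> col_set m n Z y" "P \<in> col_set m n Z' y'"
    and Q: "Q \<in> col_set m n Z y" "Q \<in> col_set m n Z' y'" and ne: "P \<noteq> Q"
  shows "col_set m n Z y = col_set m n Z' y'"
proof -
  have "\<exists>k. \<forall>j<n. y' j = k * y j"
    if y: "Q \<in> col_set m n P y" and y': "Q \<in> col_set m n P y'" for y y'
  proof -
    from y obtain w where w: "Q \<in> carrier_mat m n" "\<forall>i<m. \<forall>j<n. Q $$ (i, j) = P $$ (i, j) + w i * y j"
      by (rule col_setE)
    from y' obtain w' where w': "\<forall>i<m. \<forall>j<n. Q $$ (i, j) = P $$ (i, j) + w' i * y' j" by (rule col_setE)
    have Pc: "P \<in> carrier_mat m n" using P(1) by (rule col_setE)
    have "\<exists>i<m. w' i \<noteq> 0"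
    proof (rule ccontr)
      assume "\<not> ?thesis"
      then have "P = Q" using w' Pc w(1) by (intro eq_matI) auto
      with ne show False ..
    qed
    then obtain i where i: "i < m" "w' i \<noteq> 0" by blast
    have "y' j = inverse (w' i) * w i * y j" if "j < n" for j
    proof -
      have "w' i * y' j = w i * y j" using w w' i that by (metis add_left_cancel)
      then have "inverse (w' i) * (w' i * y' j) = inverse (w' i) * (w i * y j)" by simp
      then show ?thesis using i by (simp add: mult.assoc[symmetric])
    qed
    then show ?thesis by blast
  qed
  note par = this
  have sub: "col_set m n P y' \<subseteq> col_set m n P y" if k: "\<forall>j<n. y' j = k * y j" for k y y'
  proof
    fix X assume "X \<in> col_set m n P y'"
    then obtain w where "X \<in> carrier_mat m n" "\<forall>i<m. \<forall>j<n. X $$ (i, j) = P $$ (i, j) + w i * y' j"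
      by (rule col_setE)
    then show "X \<in> col_set m n P y"
      using k by (intro col_setI[where w = "\<lambda>i. w i * k"]) (simp_all add: mult.assoc)
  qed
  have y: "Q \<in> col_set m n P y" and y': "Q \<in> col_set m n P y'"
    using Q col_set_rebase[OF P(1)] col_set_rebase[OF P(2)] by simp_all
  from par[OF y y'] sub have "col_set m n P y' \<subseteq> col_set m n P y" by blast
  moreover from par[OF y' y] sub have "col_set m n P y \<subseteq> col_set m n P y'" by blast
  ultimately show ?thesis using col_set_rebase[OF P(1)] col_set_rebase[OF P(2)] by simp
qed

subsection \<open>Common neighbours in the \<open>2\<close> by \<open>n\<close> case\<close>

text \<open>The common neighbours of two matrices at distance two in the \<open>2\<close> by \<open>n\<close> case: \<open>C i j\<close> is
  \<open>A + \<pi> * (B - A)\<close> with \<open>\<pi>\<close> the projection of the plane onto the line \<open>i\<close> along the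
  line \<open>j\<close>. The type of indices is the projective line.\<close>
definition frame :: "nat \<Rightarrow> nat \<Rightarrow> 'a::division_ring mat \<Rightarrow> 'a mat \<Rightarrow> ('c \<Rightarrow> 'c \<Rightarrow> 'a mat) \<Rightarrow> bool" where
  "frame m n A B C \<longleftrightarrow>
    (\<forall>i j. i \<noteq> j \<longrightarrow> C i j \<in> carrier_mat m n \<and> adjacent A (C i j) \<and> adjacent B (C i j)) \<and>
    (\<forall>i j k. i \<noteq> j \<longrightarrow> i \<noteq> k \<longrightarrow> j \<noteq> k \<longrightarrow> adjacent (C i j) (C i k) \<and> adjacent (C j i) (C k i)) \<and>
    (\<forall>X\<in>carrier_mat m n. near m n A X \<longrightarrow> (\<exists>i. \<forall>j. i \<noteq> j \<longrightarrow> near m n X (C i j))) \<and>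
    (\<forall>X\<in>carrier_mat m n. near m n B X \<longrightarrow> (\<exists>j. \<forall>i. i \<noteq> j \<longrightarrow> near m n X (C i j)))"

text \<open>\<open>'a option\<close> is the projective line over \<open>'a\<close>: \<open>line_vec k\<close> spans the line \<open>k\<close> and
  \<open>line_fun k\<close> is a row functional with kernel \<open>k\<close>.\<close>
definition line_vec :: "'a::division_ring option \<Rightarrow> nat \<Rightarrow> 'a" where
  "line_vec k i = (case k of None \<Rightarrow> (if i = 0 then 0 else 1) | Some t \<Rightarrow> (if i = 0 then 1 else t))"

definition line_fun :: "'a::division_ring option \<Rightarrow> nat \<Rightarrow> 'a" where
  "line_fun k i = (case k of None \<Rightarrow> (if i = 0 then 1 else 0) | Some t \<Rightarrow> (if i = 0 then - t else 1))"

definition line_pair :: "'a::division_ring option \<Rightarrow> 'a option \<Rightarrow> 'a" where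
  "line_pair k l = line_fun k 0 * line_vec l 0 + line_fun k 1 * line_vec l 1"

lemma line_pair_eq_0_iff: "line_pair k l = 0 \<longleftrightarrow> k = l"
  by (auto simp: line_pair_def line_fun_def line_vec_def split: option.splits)

lemma line_vec_nonzero: "\<exists>a<2. line_vec k a \<noteq> 0"
  by (rule exI[of _ "if k = None then 1 else 0"]) (auto simp: line_vec_def)

lemma less_2_iff: "(a::nat) < 2 \<longleftrightarrow> a = 0 \<or> a = 1"
  by auto

text \<open>The two summands are the entries of the projection onto line \<open>i\<close> along
  \<open>j\<close> and of the one onto \<open>j\<close> along \<open>i\<close>; their sum is the
  identity of the plane.\<close>

lemma line_resolution:
  assumes "i \<noteq> j" "a < 2" "b < 2"
  shows "line_vec i a * inverse (line_pair j i) * line_fun j b +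
    line_vec j a * inverse (line_pair i j) * line_fun i b = (if a = b then 1 else 0)"
proof -
  have *: "- (s * inverse (s - t) * t) = t * inverse (t - s) * s"
    "- (inverse (s - t) * t) - inverse (t - s) * s = 1"
    "inverse (s - t) + inverse (t - s) = 0" "s * inverse (s - t) + t * inverse (t - s) = 1"
    if "s \<noteq> t" for s t :: 'a
  proof -
    \<comment> \<open>Substituting \<open>s = t + c\<close> lets \<open>inverse c\<close> cancel on
      either side without commuting scalars.\<close>
    define c where "c = s - t"
    have c: "c \<noteq> 0" "s = t + c" using that by (auto simp: c_def)
    have "t - s = - c" by (simp add: c_def)
    then have inv: "inverse (t - s) = - inverse c" by (simp add: inverse_minus_eq)
    have a: "s * inverse c * t = t * inverse c * t + t" "t * inverse c * s = t * inverse c * t + t"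
      "inverse c * s = inverse c * t + 1" "s * inverse c = t * inverse c + 1"
      unfolding c(2) using c(1) by (simp_all add: distrib_left distrib_right mult.assoc)
    show "- (s * inverse (s - t) * t) = t * inverse (t - s) * s"
      unfolding inv c_def[symmetric] by (simp add: a(1,2))
    show "- (inverse (s - t) * t) - inverse (t - s) * s = 1"
      unfolding inv c_def[symmetric] by (simp add: a(3))
    show "inverse (s - t) + inverse (t - s) = 0"
      unfolding inv c_def[symmetric] by simp
    show "s * inverse (s - t) + t * inverse (t - s) = 1"
      unfolding inv c_def[symmetric] by (simp add: a(4))
  qed
  show ?thesis
  proof (cases i; cases j)
    fix s t assume "i = Some s" "j = Some t"
    with assms *[of s t] show ?thesis
      by (auto simp: less_2_iff line_vec_def line_fun_def line_pair_def)
  qed (use assms in \<open>auto simp: less_2_iff line_vec_def line_fun_def line_pair_def\<close>)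
qed

lemma vec2_on_line:
  fixes s :: "nat \<Rightarrow> 'a::division_ring"
  obtains k l where "\<forall>a<2. s a = line_vec k a * l"
proof (cases "s 0 = 0")
  case True
  then show thesis by (intro that[of None "s 1"]) (auto simp: less_2_iff line_vec_def)
next
  case False
  then show thesis
    by (intro that[of "Some (s 1 * inverse (s 0))" "s 0"]) (auto simp: less_2_iff line_vec_def mult.assoc)
qed

lemma ex_frame:
  fixes A B :: "'a::division_ring mat"
  assumes A: "A \<in> carrier_mat 2 n" and B: "B \<in> carrier_mat 2 n" and far: "\<not> near 2 n A B"
  obtains C :: "'a option \<Rightarrow> 'a option \<Rightarrow> 'a mat" where "frame 2 n A B C"
proof -
  define D where "D a b = B $$ (a, b) - A $$ (a, b)" for a b
  have BD: "B $$ (a, b) = A $$ (a, b) + D a b" for a b by (simp add: D_def)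
  \<comment> \<open>The two rows of \<open>B - A\<close> are left independent, as otherwise one
    would be a multiple of the other and \<open>A\<close>, \<open>B\<close> would be near.\<close>
  have indep: "p = 0 \<and> q = 0" if pq: "\<forall>b<n. p * D 0 b + q * D 1 b = 0" for p q
  proof (rule ccontr)
    assume "\<not> ?thesis"
    then consider "p \<noteq> 0" | "q \<noteq> 0" by blast
    then have "near 2 n A B"
    proof cases
      case 1
      have "D 0 b = - inverse p * q * D 1 b" if "b < n" for b
      proof -
        have "p * D 0 b = - (q * D 1 b)" using pq that by (simp add: eq_neg_iff_add_eq_0)
        then have "inverse p * (p * D 0 b) = inverse p * - (q * D 1 b)" by simp
        then show ?thesis using 1 by (simp add: mult.assoc[symmetric])
      qed
      then have "B $$ (a, b) = A $$ (a, b) + (if a = 0 then - inverse p * q else 1) * D 1 b"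
        if "a < 2" "b < n" for a b
        using that BD[of a b] by (auto simp: less_2_iff)
      then show ?thesis by (rule nearI)
    next
      case 2
      have "D 1 b = - inverse q * p * D 0 b" if "b < n" for b
      proof -
        have "q * D 1 b = - (p * D 0 b)" using pq that by (simp add: eq_neg_iff_add_eq_0 add.commute)
        then have "inverse q * (q * D 1 b) = inverse q * - (p * D 0 b)" by simp
        then show ?thesis using 2 by (simp add: mult.assoc[symmetric])
      qed
      then have "B $$ (a, b) = A $$ (a, b) + (if a = 0 then 1 else - inverse q * p) * D 0 b"
        if "a < 2" "b < n" for a b
        using that BD[of a b] by (auto simp: less_2_iff)
      then show ?thesis by (rule nearI)
    qed
    with far show False ..
  qed
  \<comment> \<open>The row for which \<open>line_vec i\<close> times \<open>g j i\<close> is the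
    projection onto \<open>i\<close> along \<open>j\<close> applied to \<open>D\<close>. For
    \<open>i = j\<close> the convention \<open>inverse 0 = 0\<close> makes \<open>C i i\<close>
    equal to \<open>A\<close>.\<close>
  define g where "g j i b = inverse (line_pair j i) * (line_fun j 0 * D 0 b + line_fun j 1 * D 1 b)" for j i b
  define C where "C i j = mat 2 n (\<lambda>(a, b). A $$ (a, b) + line_vec i a * g j i b)" for i j
  have Cc: "C i j \<in> carrier_mat 2 n" for i j by (simp add: C_def)
  have CA: "C i j $$ (a, b) = A $$ (a, b) + line_vec i a * g j i b" if "a < 2" "b < n" for i j a b
    using that by (simp add: C_def)
  \<comment> \<open>Seen from \<open>B\<close>, the same matrix arises by subtracting the
    complementary projection, by \<open>line_resolution\<close>.\<close>
  have CB: "C i j $$ (a, b) = B $$ (a, b) - line_vec j a * g i j b" if ij: "i \<noteq> j" and ab: "a < 2" "b < n" for i j a b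
  proof -
    have "line_vec i a * g j i b + line_vec j a * g i j b =
        (line_vec i a * inverse (line_pair j i) * line_fun j 0 + line_vec j a * inverse (line_pair i j) * line_fun i 0) * D 0 b +
        (line_vec i a * inverse (line_pair j i) * line_fun j 1 + line_vec j a * inverse (line_pair i j) * line_fun i 1) * D 1 b"
      by (simp add: g_def distrib_left distrib_right mult.assoc add_ac)
    also have "\<dots> = D a b"
      using line_resolution[OF ij ab(1), of 0] line_resolution[OF ij ab(1), of 1] ab(1) by (auto simp: less_2_iff)
    finally have "line_vec i a * g j i b = D a b - line_vec j a * g i j b" by (simp add: eq_diff_eq)
    then show ?thesis using CA[OF ab] by (simp add: D_def)
  qed
  have g0: "\<exists>b<n. g j i b \<noteq> 0" if "i \<noteq> j" for i j
  proof (rule ccontr)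
    assume "\<not> ?thesis"
    then have "\<forall>b<n. line_fun j 0 * D 0 b + line_fun j 1 * D 1 b = 0"
      using line_pair_eq_0_iff[of j i] that by (auto simp: g_def)
    from indep[OF this] show False by (cases j) (auto simp: line_fun_def)
  qed
  have gne: "\<exists>b<n. g j i b \<noteq> g k i b" if ne: "i \<noteq> j" "i \<noteq> k" "j \<noteq> k" for i j k
  proof (rule ccontr)
    assume "\<not> ?thesis"
    then have eq: "g j i b = g k i b" if "b < n" for b using that by blast
    define p where "p a = inverse (line_pair j i) * line_fun j a - inverse (line_pair k i) * line_fun k a" for a
    have "p 0 * D 0 b + p 1 * D 1 b = 0" if "b < n" for b
    proof -
      have "p 0 * D 0 b + p 1 * D 1 b = g j i b - g k i b"
        by (simp add: p_def g_def distrib_left left_diff_distrib mult.assoc)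
      with eq[OF that] show ?thesis by simp
    qed
    then have "p 0 = 0 \<and> p 1 = 0" by (intro indep) blast
    \<comment> \<open>Evaluating on \<open>line_vec j\<close> kills the part from
      \<open>line_fun j\<close>; the part from \<open>line_fun k\<close> survives because
      \<open>k\<close> differs from both \<open>i\<close> and \<open>j\<close>.\<close>
    then have "0 = p 0 * line_vec j 0 + p 1 * line_vec j 1" by simp
    also have "\<dots> = inverse (line_pair j i) * line_pair j j - inverse (line_pair k i) * line_pair k j"
      by (simp add: p_def line_pair_def distrib_left left_diff_distrib mult.assoc)
    finally have "inverse (line_pair k i) * line_pair k j = 0" using line_pair_eq_0_iff[of j j] by simp
    then show False using ne line_pair_eq_0_iff[of k i] line_pair_eq_0_iff[of k j] by simp
  qed
  have nA: "near 2 n A (C i j)" for i j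
    by (rule nearI[where x = "line_vec i" and y = "g j i"]) (rule CA)
  have nB: "near 2 n B (C i j)" if "i \<noteq> j" for i j
    by (rule nearI[where x = "line_vec j" and y = "\<lambda>b. - g i j b"]) (simp add: CB[OF that])
  \<comment> \<open>All \<open>C i j\<close> with fixed \<open>i\<close> lie in the row set through
    \<open>A\<close> with direction \<open>line_vec i\<close>, and so does \<open>X\<close>.\<close>
  have lineA: "near 2 n X (C i j)"
    if X: "\<forall>a<2. \<forall>b<n. X $$ (a, b) = A $$ (a, b) + line_vec i a * h b" for X i j h
    using X by (intro nearI[where x = "line_vec i" and y = "\<lambda>b. g j i b - h b"]) (simp add: CA right_diff_distrib)
  have lineB: "near 2 n X (C i j)"
    if "i \<noteq> j" and X: "\<forall>a<2. \<forall>b<n. X $$ (a, b) = B $$ (a, b) + line_vec j a * h b" for X i j h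
    using X by (intro nearI[where x = "line_vec j" and y = "\<lambda>b. - g i j b - h b"])
      (simp add: CB[OF that(1)] right_diff_distrib)
  have frame: "frame 2 n A B C" unfolding frame_def
  proof (intro conjI allI impI ballI)
    fix i j :: "'a option" assume ij: "i \<noteq> j"
    show "C i j \<in> carrier_mat 2 n" by (rule Cc)
    have "A \<noteq> C i j"
    proof
      assume eq: "A = C i j"
      obtain a b where ab: "a < 2" "line_vec i a \<noteq> 0" "b < n" "g j i b \<noteq> 0"
        using line_vec_nonzero[of i] g0[OF ij] by blast
      from CA[OF ab(1,3), of i j] ab show False unfolding eq[symmetric] by simp
    qed
    then show "adjacent A (C i j)" using nA adjacent_iff[OF A Cc] by blast
    have "B \<noteq> C i j"
    proof
      assume eq: "B = C i j"
      obtain a b where ab: "a < 2" "line_vec j a \<noteq> 0" "b < n" "g i j b \<noteq> 0"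
        using line_vec_nonzero[of j] g0[of j i] ij by blast
      from CB[OF ij ab(1,3)] ab show False unfolding eq[symmetric] by simp
    qed
    then show "adjacent B (C i j)" using nB[OF ij] adjacent_iff[OF B Cc] by blast
  next
    fix i j k :: "'a option" assume ne: "i \<noteq> j" "i \<noteq> k" "j \<noteq> k"
    obtain a b where ab: "a < 2" "line_vec i a \<noteq> 0" "b < n" "g j i b \<noteq> g k i b"
      using line_vec_nonzero[of i] gne[OF ne] by blast
    have "C i j $$ (a, b) \<noteq> C i k $$ (a, b)" using ab by (simp add: CA)
    then have "C i j \<noteq> C i k" by auto
    moreover have "near 2 n (C i j) (C i k)" by (rule lineA[where h = "g j i"]) (simp add: CA)
    ultimately show "adjacent (C i j) (C i k)" using adjacent_iff[OF Cc Cc] by blast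
    have "C j i $$ (a, b) \<noteq> C k i $$ (a, b)" using ab ne by (simp add: CB)
    then have "C j i \<noteq> C k i" by auto
    moreover have "near 2 n (C j i) (C k i)"
      using ne by (intro lineB[where h = "\<lambda>b. - g j i b"]) (simp_all add: CB)
    ultimately show "adjacent (C j i) (C k i)" using adjacent_iff[OF Cc Cc] by blast
  next
    fix X assume "X \<in> carrier_mat 2 n" "near 2 n A X"
    from this(2) obtain s t where st: "\<forall>a<2. \<forall>b<n. X $$ (a, b) = A $$ (a, b) + s a * t b" by (rule nearE)
    obtain i l where il: "\<forall>a<2. s a = line_vec i a * l" by (rule vec2_on_line)
    have "\<forall>a<2. \<forall>b<n. X $$ (a, b) = A $$ (a, b) + line_vec i a * (l * t b)"
      using st il by (simp add: mult.assoc)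
    from lineA[OF this] show "\<exists>i. \<forall>j. i \<noteq> j \<longrightarrow> near 2 n X (C i j)" by blast
  next
    fix X assume "X \<in> carrier_mat 2 n" "near 2 n B X"
    from this(2) obtain s t where st: "\<forall>a<2. \<forall>b<n. X $$ (a, b) = B $$ (a, b) + s a * t b" by (rule nearE)
    obtain j l where jl: "\<forall>a<2. s a = line_vec j a * l" by (rule vec2_on_line)
    have "\<forall>a<2. \<forall>b<n. X $$ (a, b) = B $$ (a, b) + line_vec j a * (l * t b)"
      using st jl by (simp add: mult.assoc)
    from lineB[OF _ this] show "\<exists>j. \<forall>i. i \<noteq> j \<longrightarrow> near 2 n X (C i j)" by blast
  qed
  show thesis by (rule that[OF frame])
qed

subsection \<open>Homomorphisms mapping a ball into two maximal sets\<close>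

text \<open>The conclusion of the theorem without translates: the two sets share the base point
  \<open>R\<close>. This form is stable under transposition.\<close>

definition cross_set :: "nat \<Rightarrow> nat \<Rightarrow> 'a::division_ring mat set \<Rightarrow> bool" where
  "cross_set m n T \<longleftrightarrow> (\<exists>R\<in>carrier_mat m n. \<exists>x y. (\<exists>i<m. x i \<noteq> 0) \<and> (\<exists>j<n. y j \<noteq> 0) \<and>
     T \<subseteq> row_set m n R x \<union> col_set m n R y)"

lemma cross_setI:
  assumes "R \<in> carrier_mat m n" "i < m" "x i \<noteq> 0" "j < n" "y j \<noteq> 0"
    "T \<subseteq> row_set m n R x \<union> col_set m n R y"
  shows "cross_set m n T"
  unfolding cross_set_def using assms by (intro bexI[of _ R] exI[of _ x] exI[of _ y] conjI exI[of _ i] exI[of _ j]) simp_all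

lemma cross_set_tr:
  assumes f: "anti_iso f" and T: "cross_set m n T"
  shows "cross_set n m (tr f ` T)"
proof -
  from T obtain R x y i j where R: "R \<in> carrier_mat m n" and xy: "i < m" "x i \<noteq> 0" "j < n" "y j \<noteq> 0"
    and sub: "T \<subseteq> row_set m n R x \<union> col_set m n R y" unfolding cross_set_def by blast
  have f0: "f a \<noteq> 0" if "a \<noteq> 0" for a
    using f that anti_iso_zero[OF f] unfolding anti_iso_def by (metis bij_pointE)
  have "tr f ` T \<subseteq> row_set n m (tr f R) (\<lambda>j. f (y j)) \<union> col_set n m (tr f R) (\<lambda>i. f (x i))"
    using image_mono[OF sub, of "tr f"] unfolding image_Un tr_row_set[OF f R] tr_col_set[OF f R] by blast
  then show ?thesis
    using xy f0 by (intro cross_setI[of "tr f R" n m j _ i] tr_carrier[OF R]) simp_all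
qed

lemma hom_carrier: "graph_hom m n m' n' \<phi> \<Longrightarrow> A \<in> carrier_mat m n \<Longrightarrow> \<phi> A \<in> carrier_mat m' n'"
  by (auto simp: graph_hom_def)

lemma hom_adjacent:
  "\<lbrakk>graph_hom m n m' n' \<phi>; A \<in> carrier_mat m n; B \<in> carrier_mat m n; adjacent A B\<rbrakk> \<Longrightarrow>
    near m' n' (\<phi> A) (\<phi> B) \<and> \<phi> A \<noteq> \<phi> B"
  using adjacent_iff[of "\<phi> A" m' n' "\<phi> B"] hom_carrier[of m n m' n' \<phi>] unfolding graph_hom_def by blast

lemma hom_near:
  assumes "graph_hom m n m' n' \<phi>" "A \<in> carrier_mat m n" "B \<in> carrier_mat m n" "near m n A B"
  shows "near m' n' (\<phi> A) (\<phi> B)"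
  using assms hom_adjacent[OF assms(1-3)] adjacent_iff[OF assms(2,3)] near_refl by (cases "A = B") auto

lemma graph_hom_tr_comp:
  fixes \<phi> :: "'a::division_ring mat \<Rightarrow> 'b::division_ring mat"
  assumes "graph_hom m n m' n' \<phi>" "anti_iso f"
  shows "graph_hom m n n' m' (\<lambda>X. tr f (\<phi> X))"
  unfolding graph_hom_def
proof (intro conjI ballI impI)
  show "(\<lambda>X. tr f (\<phi> X)) \<in> carrier_mat m n \<rightarrow> carrier_mat n' m'"
    using hom_carrier[OF assms(1)] tr_carrier by auto
  fix A B :: "'a mat" assume AB: "A \<in> carrier_mat m n" "B \<in> carrier_mat m n" "adjacent A B"
  then have "adjacent (\<phi> A) (\<phi> B)" using assms(1) unfolding graph_hom_def by blast
  then show "adjacent (tr f (\<phi> A)) (tr f (\<phi> B))"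
    using adjacent_tr[OF assms(2)] hom_carrier[OF assms(1)] AB by blast
qed

lemma graph_hom_comp_tr:
  fixes \<phi> :: "'a::division_ring mat \<Rightarrow> 'b::division_ring mat" and f :: "'c::division_ring \<Rightarrow> 'a"
  assumes "graph_hom m n m' n' \<phi>" "anti_iso f"
  shows "graph_hom n m m' n' (\<lambda>X. \<phi> (tr f X))"
  unfolding graph_hom_def
proof (intro conjI ballI impI)
  show "(\<lambda>X. \<phi> (tr f X)) \<in> carrier_mat n m \<rightarrow> carrier_mat m' n'"
    using hom_carrier[OF assms(1)] tr_carrier by auto
  fix A B :: "'c mat" assume AB: "A \<in> carrier_mat n m" "B \<in> carrier_mat n m" "adjacent A B"
  then have "adjacent (tr f A) (tr f B)" using adjacent_tr[OF assms(2)] by blast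
  then show "adjacent (\<phi> (tr f A)) (\<phi> (tr f B))"
    using assms(1) tr_carrier[OF AB(1)] tr_carrier[OF AB(2)] unfolding graph_hom_def by blast
qed

text \<open>The projective line has one point more than the ring, hence at least five.\<close>

lemma ex_option_not_in:
  assumes "infinite (UNIV :: 'a set) \<or> card (UNIV :: 'a set) \<ge> 4" and S: "card S < 5" "finite S"
  shows "\<exists>e :: 'a option. e \<notin> S"
proof (rule ccontr)
  assume "\<not> ?thesis"
  then have U: "S = UNIV" by blast
  then have "finite (UNIV :: 'a option set)" using S by simp
  then have "finite (UNIV :: 'a set)" by simp
  moreover have "card (UNIV :: 'a option set) = Suc (card (UNIV :: 'a set))" if "finite (UNIV :: 'a set)"
    using that by (simp add: UNIV_option_conv card_image)
  ultimately show False using assms U by simp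
qed

text \<open>Only the number of rows in the domain is fixed. The scalars and the target format stay
  free, so that the results can be reused after transposing the domain or the target.\<close>

locale small_hom =
  fixes n m' n' and \<phi> :: "'a::division_ring mat \<Rightarrow> 'b::division_ring mat"
  assumes big: "infinite (UNIV :: 'a set) \<or> card (UNIV :: 'a set) \<ge> 4"
    and hom: "graph_hom 2 n m' n' \<phi>"
begin

lemma ex_index: "\<exists>e :: 'a option. e \<noteq> a \<and> e \<noteq> b \<and> e \<noteq> c \<and> e \<noteq> d"
proof -
  have "card {a, b, c, d} < 5" by (simp add: card_insert_if)
  from ex_option_not_in[OF big this] show ?thesis by auto
qed

text \<open>A matrix \<open>B\<close> mapped outside the row set \<open>M\<close> determines a column set containing the images of
  all its neighbours: each neighbour of \<open>B\<close> is adjacent to two members of a frame between \<open>A\<close> and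
  \<open>B\<close>, whose images lie in \<open>M\<close>. For any two such matrices there are two
  matrices with distinct images, each equal or adjacent to both of them, so their column sets coincide.\<close>
lemma ball_in_row_set:
  assumes A: "A \<in> carrier_mat 2 n" and B: "B \<in> carrier_mat 2 n" and x: "i0 < m'" "x i0 \<noteq> 0"
    and M: "\<And>X. X \<in> carrier_mat 2 n \<Longrightarrow> near 2 n A X \<Longrightarrow> \<phi> X \<in> row_set m' n' O1 x"
    and BM: "\<phi> B \<notin> row_set m' n' O1 x"
  shows "cross_set m' n' (\<phi> ` carrier_mat 2 n)"
proof -
  let ?M = "row_set m' n' O1 x"
  have star: "\<exists>y R. (\<exists>j<n'. y j \<noteq> 0) \<and> R \<in> ?M \<and> R \<in> col_set m' n' (\<phi> B) y \<and>
      (\<forall>X\<in>carrier_mat 2 n. near 2 n B X \<longrightarrow> \<phi> X \<in> col_set m' n' (\<phi> B) y)"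
    if B: "B \<in> carrier_mat 2 n" "\<phi> B \<notin> ?M" for B
  proof -
    have "\<not> near 2 n A B" using M B by blast
    then obtain C :: "'a option \<Rightarrow> 'a option \<Rightarrow> 'a mat" where C: "frame 2 n A B C"
      by (rule ex_frame[OF A B(1)])
    have Cc: "C i j \<in> carrier_mat 2 n" "adjacent A (C i j)" "adjacent B (C i j)" if "i \<noteq> j" for i j
      using C that unfolding frame_def by blast+
    have CM: "\<phi> (C i j) \<in> ?M" if "i \<noteq> j" for i j
      using M[OF Cc(1)[OF that]] Cc(2)[OF that] adjacent_iff[OF A Cc(1)[OF that]] by blast
    have CB: "near m' n' (\<phi> B) (\<phi> (C i j))" if "i \<noteq> j" for i j
      using hom_adjacent[OF hom B(1) Cc(1)[OF that] Cc(3)[OF that]] by blast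
    have ij: "None \<noteq> Some (0::'a)" by simp
    obtain y where y: "\<exists>j<n'. y j \<noteq> 0"
      and nbr: "\<And>r. r \<in> ?M \<Longrightarrow> near m' n' (\<phi> B) r \<Longrightarrow> r \<in> col_set m' n' (\<phi> B) y"
      and tri: "\<And>r1 r2 X. \<lbrakk>r1 \<in> ?M; r2 \<in> ?M; r1 \<noteq> r2; near m' n' (\<phi> B) r1; near m' n' (\<phi> B) r2;
        X \<in> carrier_mat m' n'; near m' n' r1 X; near m' n' r2 X; near m' n' (\<phi> B) X\<rbrakk> \<Longrightarrow>
        X \<in> col_set m' n' (\<phi> B) y"
      using ex_col_set_through_neighbours[OF x hom_carrier[OF hom B(1)] B(2) CM[OF ij] near_sym[OF CB[OF ij]]]
      by blast
    have "\<phi> X \<in> col_set m' n' (\<phi> B) y" if X: "X \<in> carrier_mat 2 n" "near 2 n B X" for X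
    proof -
      from C X obtain j where j: "\<And>i. i \<noteq> j \<Longrightarrow> near 2 n X (C i j)" unfolding frame_def by blast
      obtain i where i: "i \<noteq> j" using ex_index by blast
      obtain k where k: "k \<noteq> i" "k \<noteq> j" using ex_index by blast
      \<comment> \<open>Two frame members in column \<open>j\<close> are both near \<open>X\<close>,
        and their adjacency keeps the images distinct, as \<open>tri\<close> demands.\<close>
      have "adjacent (C i j) (C k j)" using C i k unfolding frame_def by metis
      then have ne: "\<phi> (C i j) \<noteq> \<phi> (C k j)" using hom_adjacent[OF hom Cc(1) Cc(1)] i k by blast
      have near: "near m' n' (\<phi> (C l j)) (\<phi> X)" if "l \<noteq> j" for l
        by (rule hom_near[OF hom Cc(1)[OF that] X(1) near_sym[OF j[OF that]]])
      show ?thesis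
        by (rule tri[OF CM[OF i] CM[OF k(2)] ne CB[OF i] CB[OF k(2)] hom_carrier[OF hom X(1)]
              near[OF i] near[OF k(2)] hom_near[OF hom B(1) X]])
    qed
    then show ?thesis using y CM[OF ij] nbr[OF CM[OF ij] CB[OF ij]] by blast
  qed
  from star[OF B BM] obtain y R j0 where y: "j0 < n'" "y j0 \<noteq> 0" and R: "R \<in> ?M" "R \<in> col_set m' n' (\<phi> B) y"
    and yB: "\<And>X. X \<in> carrier_mat 2 n \<Longrightarrow> near 2 n B X \<Longrightarrow> \<phi> X \<in> col_set m' n' (\<phi> B) y" by blast
  have "\<phi> X \<in> ?M \<union> col_set m' n' (\<phi> B) y" if X: "X \<in> carrier_mat 2 n" for X
  proof (cases "\<phi> X \<in> ?M \<or> X = B")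
    case True
    then show ?thesis using yB[OF B near_refl] by blast
  next
    case False
    with star[OF X] obtain y' where
      yX: "\<And>Y. Y \<in> carrier_mat 2 n \<Longrightarrow> near 2 n X Y \<Longrightarrow> \<phi> Y \<in> col_set m' n' (\<phi> X) y'" by blast
    \<comment> \<open>If \<open>B\<close> and \<open>X\<close> are adjacent they serve themselves;
      otherwise two adjacent members of a frame between them do.\<close>
    have "\<exists>P Q. P \<in> carrier_mat 2 n \<and> Q \<in> carrier_mat 2 n \<and> \<phi> P \<noteq> \<phi> Q \<and>
        near 2 n B P \<and> near 2 n B Q \<and> near 2 n X P \<and> near 2 n X Q"
    proof (cases "near 2 n B X")
      case True
      then have "adjacent B X" using adjacent_iff[OF B X] False by blast
      then have "\<phi> B \<noteq> \<phi> X" using hom_adjacent[OF hom B X] by blast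
      then show ?thesis using B X True near_sym[OF True] near_refl by blast
    next
      case nr: False
      then obtain C :: "'a option \<Rightarrow> 'a option \<Rightarrow> 'a mat" where C: "frame 2 n B X C"
        by (rule ex_frame[OF B X])
      have Cc: "C i j \<in> carrier_mat 2 n" "near 2 n B (C i j)" "near 2 n X (C i j)" if "i \<noteq> j" for i j
        using C that adjacent_iff[of _ 2 n "C i j"] B X unfolding frame_def by blast+
      have ne: "None \<noteq> Some (0::'a)" "None \<noteq> Some (1::'a)" "Some 0 \<noteq> Some (1::'a)" by simp_all
      have "adjacent (C None (Some 0)) (C None (Some 1))" using C ne unfolding frame_def by blast
      then have "\<phi> (C None (Some 0)) \<noteq> \<phi> (C None (Some 1))"
        using hom_adjacent[OF hom Cc(1)[OF ne(1)] Cc(1)[OF ne(2)]] by blast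
      then show ?thesis using Cc[OF ne(1)] Cc[OF ne(2)] by blast
    qed
    then obtain P Q where PQ: "P \<in> carrier_mat 2 n" "Q \<in> carrier_mat 2 n" "\<phi> P \<noteq> \<phi> Q"
      "near 2 n B P" "near 2 n B Q" "near 2 n X P" "near 2 n X Q" by blast
    have "col_set m' n' (\<phi> B) y = col_set m' n' (\<phi> X) y'"
      by (rule col_set_eqI[OF yB[OF PQ(1,4)] yX[OF PQ(1,6)] yB[OF PQ(2,5)] yX[OF PQ(2,7)] PQ(3)])
    then show ?thesis using yX[OF X near_refl] by blast
  qed
  then have sub: "\<phi> ` carrier_mat 2 n \<subseteq> row_set m' n' R x \<union> col_set m' n' R y"
    unfolding row_set_rebase[OF R(1), symmetric] col_set_rebase[OF R(2), symmetric] by blast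
  have "R \<in> carrier_mat m' n'" using R(1) by (rule row_setE)
  then show ?thesis using x y sub by (rule cross_setI)
qed

end

context small_hom
begin

text \<open>Transposing the target over the opposite ring exchanges row and column sets and leaves
  the domain with its two rows untouched.\<close>

lemma ball_in_col_set:
  assumes A: "A \<in> carrier_mat 2 n" and B: "B \<in> carrier_mat 2 n" and O1: "O1 \<in> carrier_mat m' n'"
    and y: "j0 < n'" "y j0 \<noteq> 0"
    and N: "\<And>X. X \<in> carrier_mat 2 n \<Longrightarrow> near 2 n A X \<Longrightarrow> \<phi> X \<in> col_set m' n' O1 y"
    and BN: "\<phi> B \<notin> col_set m' n' O1 y"
  shows "cross_set m' n' (\<phi> ` carrier_mat 2 n)"
proof -
  note f = anti_iso_Opp[where 'a = 'b]
  note inv_tr = tr_inv_tr[OF f]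
  let ?f = "tr (Opp :: 'b \<Rightarrow> 'b opp)"
  let ?\<psi> = "\<lambda>X. ?f (\<phi> X)"
  have yO: "Opp (y j0) \<noteq> 0" using y by (simp add: zero_opp_def Opp_inject)
  interpret tr: small_hom n n' m' ?\<psi>
    by unfold_locales (rule big, rule graph_hom_tr_comp[OF hom f])
  have set: "?f ` col_set m' n' O1 y = row_set n' m' (?f O1) (\<lambda>j. Opp (y j))"
    by (rule tr_col_set[OF f O1])
  have "cross_set n' m' (?\<psi> ` carrier_mat 2 n)"
  proof (rule tr.ball_in_row_set[OF A B y(1), where x = "\<lambda>j. Opp (y j)" and ?O1.0 = "?f O1"])
    show "?\<psi> X \<in> row_set n' m' (?f O1) (\<lambda>j. Opp (y j))" if "X \<in> carrier_mat 2 n" "near 2 n A X" for X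
      using N[OF that] unfolding set[symmetric] by (rule imageI)
    show "?\<psi> B \<notin> row_set n' m' (?f O1) (\<lambda>j. Opp (y j))"
    proof
      assume "?\<psi> B \<in> row_set n' m' (?f O1) (\<lambda>j. Opp (y j))"
      then obtain X where X: "X \<in> col_set m' n' O1 y" "?f (\<phi> B) = ?f X" unfolding set[symmetric] by blast
      have "X \<in> carrier_mat m' n'" using X(1) by (rule col_setE)
      then have "\<phi> B = X" using X(2) inv_tr hom_carrier[OF hom B] by metis
      with X BN show False by simp
    qed
  qed (rule yO)
  from cross_set_tr[OF anti_iso_inv[OF f] this]
  have "cross_set m' n' ((\<lambda>X. tr (inv_into UNIV Opp) (?f (\<phi> X))) ` carrier_mat 2 n)"
    by (simp add: image_image)
  also have "(\<lambda>X. tr (inv_into UNIV Opp) (?f (\<phi> X))) ` carrier_mat 2 n = \<phi> ` carrier_mat 2 n"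
    using inv_tr hom_carrier[OF hom] by (intro image_cong) auto
  finally show ?thesis .
qed

text \<open>If some \<open>B\<close> is mapped outside both sets, all frame images fall into one of
  them. Every \<open>X\<close> in the ball is near a frame member whose image lies in this set only,
  which pulls \<open>\<phi> X\<close> into it.\<close>

lemma ball_in_cross:
  assumes A: "A \<in> carrier_mat 2 n" and x: "i0 < m'" "x i0 \<noteq> 0" and y: "j0 < n'" "y j0 \<noteq> 0"
    and ball: "\<And>X. X \<in> carrier_mat 2 n \<Longrightarrow> near 2 n A X \<Longrightarrow>
      \<phi> X \<in> row_set m' n' (\<phi> A) x \<or> \<phi> X \<in> col_set m' n' (\<phi> A) y"
  shows "cross_set m' n' (\<phi> ` carrier_mat 2 n)"
proof (cases "\<phi> ` carrier_mat 2 n \<subseteq> row_set m' n' (\<phi> A) x \<union> col_set m' n' (\<phi> A) y")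
  case True
  with hom_carrier[OF hom A] x y show ?thesis by (rule cross_setI)
next
  case False
  let ?M = "row_set m' n' (\<phi> A) x" and ?N = "col_set m' n' (\<phi> A) y"
  from False obtain B where B: "B \<in> carrier_mat 2 n" "\<phi> B \<notin> ?M" "\<phi> B \<notin> ?N" by blast
  have Bc: "\<phi> B \<in> carrier_mat m' n'" by (rule hom_carrier[OF hom B(1)])
  have "\<not> near 2 n A B" using ball B by blast
  then obtain C :: "'a option \<Rightarrow> 'a option \<Rightarrow> 'a mat" where C: "frame 2 n A B C"
    by (rule ex_frame[OF A B(1)])
  define F where "F i j = \<phi> (C i j)" for i j
  have Cc: "C i j \<in> carrier_mat 2 n" "adjacent A (C i j)" "adjacent B (C i j)" if "i \<noteq> j" for i j
    using C that unfolding frame_def by blast+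
  have FMN: "F i j \<in> ?M \<or> F i j \<in> ?N" if "i \<noteq> j" for i j
    using ball[OF Cc(1)[OF that]] Cc(2)[OF that] adjacent_iff[OF A Cc(1)[OF that]] unfolding F_def by blast
  have FB: "near m' n' (F i j) (\<phi> B)" if "i \<noteq> j" for i j
    using hom_adjacent[OF hom B(1) Cc(1)[OF that] Cc(3)[OF that]] near_sym unfolding F_def by blast
  have Frow: "near m' n' (F i j) (F i k) \<and> F i j \<noteq> F i k" if "i \<noteq> j" "i \<noteq> k" "j \<noteq> k" for i j k
  proof -
    have "adjacent (C i j) (C i k)" using C that unfolding frame_def by blast
    then show ?thesis unfolding F_def using hom_adjacent[OF hom Cc(1)[OF that(1)] Cc(1)[OF that(2)]] by blast
  qed
  have Fcol: "near m' n' (F j i) (F k i)" if "i \<noteq> j" "i \<noteq> k" "j \<noteq> k" for i j k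
  proof -
    have "adjacent (C j i) (C k i)" using C that unfolding frame_def by blast
    then show ?thesis unfolding F_def using hom_adjacent[OF hom Cc(1) Cc(1)] that by metis
  qed
  have sep: "P \<in> ?N \<or> Q \<in> ?M" if "P \<in> ?M" "Q \<in> ?N" "near m' n' P Q" for P Q
    by (rule near_row_col[OF x y that])
  \<comment> \<open>Two distinct images in the intersection, both near \<open>\<phi> B\<close>,
    would put \<open>\<phi> B\<close> into one of the sets by \<open>near_two_meet\<close>.\<close>
  have "\<exists>b. \<forall>j. i \<noteq> j \<longrightarrow> F i j \<in> ?M \<longrightarrow> F i j \<in> ?N \<longrightarrow> j = b" for i
  proof (cases "\<exists>b. i \<noteq> b \<and> F i b \<in> ?M \<and> F i b \<in> ?N")
    case True
    then obtain b where b: "i \<noteq> b" "F i b \<in> ?M" "F i b \<in> ?N" by blast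
    have "j = b" if j: "i \<noteq> j" "F i j \<in> ?M" "F i j \<in> ?N" for j
    proof (rule ccontr)
      assume "j \<noteq> b"
      then have "F i j \<noteq> F i b" using Frow j b by blast
      from near_two_meet[OF x y Bc j(2,3) b(2,3) this FB[OF j(1)] FB[OF b(1)]] B show False by blast
    qed
    then show ?thesis by blast
  qed blast
  then obtain b where b: "\<And>i j. i \<noteq> j \<Longrightarrow> F i j \<in> ?M \<Longrightarrow> F i j \<in> ?N \<Longrightarrow> j = b i" by metis
  \<comment> \<open>by \<open>b\<close> at most one image in each row lies in both sets; the four exclusions in the choice of
    \<open>e\<close> are possible because the projective line has at least five points\<close>
  have mono: "(\<forall>i j. i \<noteq> j \<longrightarrow> F i j \<in> ?M) \<or> (\<forall>i j. i \<noteq> j \<longrightarrow> F i j \<in> ?N)"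
  proof (rule ccontr)
    assume "\<not> ?thesis"
    then obtain i j k l where ij: "i \<noteq> j" "F i j \<notin> ?N" and kl: "k \<noteq> l" "F k l \<notin> ?M" by blast
    have ijM: "F i j \<in> ?M" using FMN[OF ij(1)] ij(2) by blast
    have klN: "F k l \<in> ?N" using FMN[OF kl(1)] kl(2) by blast
    obtain e where e: "e \<noteq> i" "e \<noteq> k" "e \<noteq> b i" "e \<noteq> b k" using ex_index by blast
    have ie: "F i e \<in> ?M" "F i e \<notin> ?N"
    proof -
      \<comment> \<open>The image \<open>F i j\<close> lies in \<open>?M\<close> only, so a
        neighbour of it in \<open>?N\<close> would have to lie in \<open>?M\<close> too, which
        \<open>e \<noteq> b i\<close> rules out.\<close>
      show N: "F i e \<notin> ?N"
      proof
        assume N: "F i e \<in> ?N"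
        then have "F i e \<notin> ?M" "e \<noteq> j" using b[of i e] e ij by auto
        with sep[OF ijM N] Frow[of i j e] ij e show False by blast
      qed
      show "F i e \<in> ?M" using FMN[of i e] N e by blast
    qed
    have ke: "F k e \<in> ?N" "F k e \<notin> ?M"
    proof -
      show M: "F k e \<notin> ?M"
      proof
        assume M: "F k e \<in> ?M"
        then have "F k e \<notin> ?N" "e \<noteq> l" using b[of k e] e kl by auto
        with sep[OF M klN] Frow[of k e l] kl e show False by blast
      qed
      show "F k e \<in> ?N" using FMN[of k e] M e by blast
    qed
    \<comment> \<open>In column \<open>e\<close> an image in \<open>?M\<close> only is now near an
      image in \<open>?N\<close> only, contradicting \<open>sep\<close>.\<close>
    have "i \<noteq> k" using ie ke by blast
    then show False using sep[OF ie(1) ke(1)] Fcol[of e i k] e ie ke by blast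
  qed
  have row: "\<exists>e. i \<noteq> e \<and> e \<noteq> b i" for i
    using ex_index[of i "b i"] by metis
  have nearX: "near m' n' (F i e) (\<phi> X)" if "i \<noteq> e" "near 2 n X (C i e)" "X \<in> carrier_mat 2 n" for i e X
    unfolding F_def by (rule hom_near[OF hom Cc(1)[OF that(1)] that(3) near_sym[OF that(2)]])
  from mono show ?thesis
  proof
    assume M: "\<forall>i j. i \<noteq> j \<longrightarrow> F i j \<in> ?M"
    show ?thesis
    proof (rule ball_in_row_set[OF A B(1) x _ B(2)])
      fix X assume X: "X \<in> carrier_mat 2 n" "near 2 n A X"
      with C obtain i where i: "\<And>j. i \<noteq> j \<Longrightarrow> near 2 n X (C i j)" unfolding frame_def by blast
      obtain e where e: "i \<noteq> e" "e \<noteq> b i" using row by blast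
      have "F i e \<in> ?M" "F i e \<notin> ?N" using M b[of i e] e by blast+
      then show "\<phi> X \<in> ?M" using ball[OF X] sep[of "F i e" "\<phi> X"] nearX[OF e(1) i[OF e(1)] X(1)] by blast
    qed
  next
    assume N: "\<forall>i j. i \<noteq> j \<longrightarrow> F i j \<in> ?N"
    show ?thesis
    proof (rule ball_in_col_set[OF A B(1) hom_carrier[OF hom A] y _ B(3)])
      fix X assume X: "X \<in> carrier_mat 2 n" "near 2 n A X"
      with C obtain i where i: "\<And>j. i \<noteq> j \<Longrightarrow> near 2 n X (C i j)" unfolding frame_def by blast
      obtain e where e: "i \<noteq> e" "e \<noteq> b i" using row by blast
      have "F i e \<in> ?N" "F i e \<notin> ?M" using N b[of i e] e by blast+
      then show "\<phi> X \<in> ?N" using ball[OF X] sep[of "\<phi> X" "F i e"] near_sym[OF nearX[OF e(1) i[OF e(1)] X(1)]] by blast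
    qed
  qed
qed

end

text \<open>Precomposition with the transposition moves the domain to matrices with two rows over
  the opposite ring, which has as many elements. The target stays the same.\<close>

lemma ball_in_cross_two_cols:
  fixes \<phi> :: "'a::division_ring mat \<Rightarrow> 'b::division_ring mat"
  assumes big: "infinite (UNIV :: 'a set) \<or> card (UNIV :: 'a set) \<ge> 4"
    and hom: "graph_hom m 2 m' n' \<phi>"
    and A: "A \<in> carrier_mat m 2" and x: "i0 < m'" "x i0 \<noteq> 0" and y: "j0 < n'" "y j0 \<noteq> 0"
    and ball: "\<And>X. X \<in> carrier_mat m 2 \<Longrightarrow> near m 2 A X \<Longrightarrow>
      \<phi> X \<in> row_set m' n' (\<phi> A) x \<or> \<phi> X \<in> col_set m' n' (\<phi> A) y"
  shows "cross_set m' n' (\<phi> ` carrier_mat m 2)"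
proof -
  note f = anti_iso_Opp[where 'a = 'a]
  note g = anti_iso_inv[OF f]
  let ?f = "tr (Opp :: 'a \<Rightarrow> 'a opp)" and ?g = "tr (inv_into UNIV (Opp :: 'a \<Rightarrow> 'a opp))"
  have bij: "bij (Opp :: 'a \<Rightarrow> 'a opp)" using f by (simp add: anti_iso_def)
  have big': "infinite (UNIV :: 'a opp set) \<or> card (UNIV :: 'a opp set) \<ge> 4"
    using big bij_betw_finite[OF bij] bij_betw_same_card[OF bij] by simp
  interpret small_hom m m' n' "\<lambda>X. \<phi> (?g X)"
    by unfold_locales (rule big', rule graph_hom_comp_tr[OF hom g])
  have gf: "?g (?f A) = A" by (rule tr_inv_tr[OF f A])
  have "cross_set m' n' ((\<lambda>X. \<phi> (?g X)) ` carrier_mat 2 m)"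
  proof (rule ball_in_cross[of "?f A" i0 x j0 y, OF tr_carrier[OF A] x y], unfold gf)
    fix X assume X: "X \<in> carrier_mat 2 m" "near 2 m (?f A) X"
    have "near m 2 A (?g X)" using near_tr[OF g tr_carrier[OF A] X] unfolding gf .
    then show "\<phi> (?g X) \<in> row_set m' n' (\<phi> A) x \<or> \<phi> (?g X) \<in> col_set m' n' (\<phi> A) y"
      by (rule ball[OF tr_carrier[OF X(1)]])
  qed
  moreover have "\<phi> ` carrier_mat m 2 \<subseteq> (\<lambda>X. \<phi> (?g X)) ` carrier_mat 2 m"
  proof
    fix Y assume "Y \<in> \<phi> ` carrier_mat m 2"
    then obtain X where X: "X \<in> carrier_mat m 2" "Y = \<phi> X" by blast
    have "?g (?f X) = X" by (rule tr_inv_tr[OF f X(1)])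
    then show "Y \<in> (\<lambda>X. \<phi> (?g X)) ` carrier_mat 2 m"
      using X tr_carrier[OF X(1), of Opp] by (intro image_eqI[of _ _ "?f X"]) simp_all
  qed
  ultimately show ?thesis unfolding cross_set_def by (meson subset_trans)
qed

section \<open>Balls, translates and the conclusion\<close>

lemma mat_rank_zero: "mat_rank (0\<^sub>m m n :: 'a::division_ring mat) = 0"
proof -
  have "I = {}" if "left_indep_rows (0\<^sub>m m n :: 'a mat) I" "I \<subseteq> {..<m}" for I
  proof -
    \<comment> \<open>With all coefficients equal to 1, zero rows give a relation that is nontrivial
      unless \<open>I\<close> is empty.\<close>
    have "(\<Sum>i\<in>I. (\<lambda>_. 1) i * (0\<^sub>m m n :: 'a mat) $$ (i, j)) = 0" if "j < n" for j
      using that \<open>I \<subseteq> {..<m}\<close> by (intro sum.neutral) auto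
    moreover have "(\<forall>j<n. (\<Sum>i\<in>I. (\<lambda>_. 1) i * (0\<^sub>m m n :: 'a mat) $$ (i, j)) = 0) \<longrightarrow> (\<forall>i\<in>I. (1::'a) = 0)"
      using that(1) unfolding left_indep_rows_def index_zero_mat by (rule spec)
    ultimately have "\<forall>i\<in>I. (1::'a) = 0" by blast
    then show ?thesis by auto
  qed
  then have "I \<subseteq> {..<m} \<and> left_indep_rows (0\<^sub>m m n :: 'a mat) I \<longleftrightarrow> I = {}" for I
    by (auto simp: left_indep_rows_def[of _ "{}"])
  then show ?thesis unfolding mat_rank_def index_zero_mat by simp
qed

lemma near_in_unit_ball:
  assumes A: "A \<in> carrier_mat m n" and X: "X \<in> carrier_mat m n" and near: "near m n A X"
  shows "X \<in> unit_ball m n A"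
proof -
  have "mat_rank (X - A) \<le> 1"
  proof (cases "X = A")
    case True
    then have "X - A = 0\<^sub>m m n" using A by auto
    then show ?thesis by (simp add: mat_rank_zero)
  next
    case False
    then have "adjacent X A" using adjacent_iff[OF X A] near_sym[OF near] by blast
    then show ?thesis by (simp add: adjacent_def)
  qed
  moreover have "X = (X - A) + A" using A X by auto
  moreover have "X - A \<in> carrier_mat m n" by (rule minus_carrier_mat[OF A])
  ultimately show ?thesis unfolding unit_ball_def rank_le_one_def by blast
qed

lemma row_set_translate:
  assumes "R \<in> carrier_mat m n"
  shows "row_set m n R x \<subseteq> (\<lambda>X. X + R) ` row_set m n (0\<^sub>m m n) x"
proof
  fix X assume "X \<in> row_set m n R x"
  then obtain v where v: "X \<in> carrier_mat m n" "\<forall>i<m. \<forall>j<n. X $$ (i, j) = R $$ (i, j) + x i * v j"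
    by (rule row_setE)
  have "X - R \<in> row_set m n (0\<^sub>m m n) x"
    using v assms by (intro row_setI[where v = v]) auto
  moreover have "X = (X - R) + R" using v(1) assms by auto
  ultimately show "X \<in> (\<lambda>X. X + R) ` row_set m n (0\<^sub>m m n) x" by (rule rev_image_eqI)
qed

lemma col_set_translate:
  assumes "R \<in> carrier_mat m n"
  shows "col_set m n R y \<subseteq> (\<lambda>X. X + R) ` col_set m n (0\<^sub>m m n) y"
proof
  fix X assume "X \<in> col_set m n R y"
  then obtain w where w: "X \<in> carrier_mat m n" "\<forall>i<m. \<forall>j<n. X $$ (i, j) = R $$ (i, j) + w i * y j"
    by (rule col_setE)
  have "X - R \<in> col_set m n (0\<^sub>m m n) y"
    using w assms by (intro col_setI[where w = w]) auto
  moreover have "X = (X - R) + R" using w(1) assms by auto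
  ultimately show "X \<in> (\<lambda>X. X + R) ` col_set m n (0\<^sub>m m n) y" by (rule rev_image_eqI)
qed

theorem theorem5p2:
  fixes \<phi> :: "'a::division_ring mat \<Rightarrow> 'b::division_ring mat"
    and m n m' n' :: nat
  assumes "infinite (UNIV :: 'a set) \<or> card (UNIV :: 'a set) \<ge> 4"
    and "m \<ge> 2" and "n \<ge> 2" and "m' \<ge> 2" and "n' \<ge> 2"
    and "min m n = 2"
    and "degenerate_hom m n m' n' \<phi>"
  shows "\<exists>M N R. maximal_different_types m' n' M N \<and>
           0\<^sub>m m' n' \<in> M \<and> 0\<^sub>m m' n' \<in> N \<and> R \<in> carrier_mat m' n' \<and>
           \<phi> ` carrier_mat m n \<subseteq> (\<lambda>X. X + R) ` M \<union> (\<lambda>X. X + R) ` N"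
proof -
  note one = maximal_type_one_iff[OF assms(4,5)] and two = maximal_type_two_iff[OF assms(4,5)]
  from assms(7) obtain A M0 N0 where hom: "graph_hom m n m' n' \<phi>" and A: "A \<in> carrier_mat m n"
    and MN0: "maximal_different_types m' n' M0 N0" "\<phi> ` unit_ball m n A \<subseteq> M0 \<union> N0" "\<phi> A \<in> M0 \<inter> N0"
    unfolding degenerate_hom_def rank_le_one_def by blast
  obtain M N where M: "maximal_type_one m' n' M" and N: "maximal_type_two m' n' N"
    and MN: "\<phi> ` unit_ball m n A \<subseteq> M \<union> N" "\<phi> A \<in> M" "\<phi> A \<in> N"
    using MN0 unfolding maximal_different_types_def by (metis IntD1 IntD2 sup_commute)
  from M obtain A1 x i0 where x: "i0 < m'" "x i0 \<noteq> 0" and M1: "M = row_set m' n' A1 x"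
    unfolding one by blast
  from N obtain A2 y j0 where y: "j0 < n'" "y j0 \<noteq> 0" and N1: "N = col_set m' n' A2 y"
    unfolding two by blast
  \<comment> \<open>Both sets contain \<open>\<phi> A\<close>, which therefore becomes their common
    base point.\<close>
  have M2: "M = row_set m' n' (\<phi> A) x" using row_set_rebase[of "\<phi> A" m' n' A1 x] MN(2) M1 by simp
  have N2: "N = col_set m' n' (\<phi> A) y" using col_set_rebase[of "\<phi> A" m' n' A2 y] MN(3) N1 by simp
  have ball: "\<phi> X \<in> row_set m' n' (\<phi> A) x \<or> \<phi> X \<in> col_set m' n' (\<phi> A) y"
    if "X \<in> carrier_mat m n" "near m n A X" for X
    using MN(1) near_in_unit_ball[OF A that] unfolding M2[symmetric] N2[symmetric] by blast
  have "cross_set m' n' (\<phi> ` carrier_mat m n)"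
  proof (cases "m = 2")
    case True
    interpret small_hom n m' n' \<phi> by unfold_locales (use assms(1) hom True in auto)
    show ?thesis using ball_in_cross[of A i0 x j0 y] A x y ball unfolding True by blast
  next
    case False
    then have "n = 2" using assms(6) by (simp add: min_def split: if_splits)
    then show ?thesis
      using ball_in_cross_two_cols[OF assms(1), of m m' n' \<phi> A i0 x j0 y] hom A x y ball by blast
  qed
  then obtain R x y where R: "R \<in> carrier_mat m' n'"
    and xy: "\<exists>i<m'. x i \<noteq> 0" "\<exists>j<n'. y j \<noteq> 0"
    and sub: "\<phi> ` carrier_mat m n \<subseteq> row_set m' n' R x \<union> col_set m' n' R y"
    unfolding cross_set_def by blast
  \<comment> \<open>The required sets through zero keep the directions \<open>x\<close> and
    \<open>y\<close>; translating them by \<open>R\<close> recovers the cross.\<close>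
  let ?Z = "0\<^sub>m m' n' :: 'b mat"
  have Z: "?Z \<in> carrier_mat m' n'" by simp
  have "maximal_type_one m' n' (row_set m' n' ?Z x)" unfolding one using Z xy(1) by blast
  moreover have "maximal_type_two m' n' (col_set m' n' ?Z y)" unfolding two using Z xy(2) by blast
  ultimately have "maximal_different_types m' n' (row_set m' n' ?Z x) (col_set m' n' ?Z y)"
    unfolding maximal_different_types_def by blast
  moreover have "\<phi> ` carrier_mat m n \<subseteq>
      (\<lambda>X. X + R) ` row_set m' n' ?Z x \<union> (\<lambda>X. X + R) ` col_set m' n' ?Z y"
    using sub row_set_translate[OF R] col_set_translate[OF R] by blast
  ultimately show ?thesis
    using base_in_row_set[OF Z] base_in_col_set[OF Z] R by blast
qed

end
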